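(* Let $\ell>0$, $\lambda>0$, and let $\phi\in V^{(\lambda)}(Z_\ell)$ be bounded on the hyperbolic cylinder $Z_\ell$. Let $L>0$, put $\varphi_0=2\arctan(\tanh(L/2))$, and suppose that $N$ is a positive integer such that $\frac{4\pi^2N^2}{\ell^2\cosh^2 L}>\lambda$. Then $$\|\phi-\phi^{(N)}\|_{L^\infty(Z^L_\ell)}\le\tilde\beta_\lambda(N)\,\|\phi\|_{L^\infty(Z_\ell)},\qquad \|\phi-\phi^{(N)}\|_{C^1(Z^L_\ell)}\le\beta_\lambda(N)\,\|\phi\|_{L^\infty(Z_\ell)},$$ where $\tilde\beta_\lambda(N)=A_1(N)$, $\beta_\lambda(N)=\sqrt{A_1(N)^2+A_2(N)^2+A_3(N)^2}$, $$A_1(N)=4\sum_{k=N+1}^\infty\frac{1}{\cosh c_k(\varphi_0)},\qquad A_2(N)=4\sum_{k=N+1}^\infty\frac{2\pi k}{\ell}\,\frac{1}{\cosh c_k(\varphi_0)},$$ $$A_3(N)=4\sum_{k=N+1}^\infty\sqrt{\frac{4\pi^2k^2}{\ell^2}-\frac{\lambda}{\cos^2\varphi_0}}\;\frac{1}{\sinh c_k(\varphi_0)},$$ and $$c_k(\varphi)=\frac{2\pi k}{\ell}\arccos\left(\frac{\frac{2\pi k}{\ell}\sin\varphi}{\sqrt{\frac{4\pi^2k^2}{\ell^2}-\lambda}}\right)-\sqrt\lambda\;\mathrm{arccot}\left(\frac{\sqrt\lambda\,\sin\varphi}{\sqrt{\frac{4\pi^2k^2}{\ell^2}\cos^2\v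arphi-\lambda}}\right).$$
   Context: The hyperbolic cylinder $Z_\ell$ is the quotient of the upper half plane (metric $y^{-2}(dx^2+dy^2)$) by the group generated by $z\mapsto e^{\ell}z$. Fermi coordinates $(\rho,t)\in\mathbb R\times\mathbb R/\ell\mathbb Z$ are given by $(x,y)=e^t(\tanh\rho,1/\cosh\rho)$. For $L>0$, $Z^L_\ell=\{-L\le\rho\le L\}\subset Z_\ell$. $\Delta$ is the positive Laplace operator. $V^{(\lambda)}(Z_\ell)$ is the space of smooth functions $f$ on $Z_\ell$ with $(\Delta-\lambda)f=0$. Every $f\in V^{(\lambda)}(Z_\ell)$ has a Fourier expansion $f=\sum_{k\in\mathbb Z}(a_k\phi_k+b_k\psi_k)$, where $\phi_k,\psi_k$ are the functions with $(\Delta-\lambda)\phi_k=(\Delta-\lambda)\psi_k=0$ and, at $\rho=0$, $\phi_k=e^{2\pi i kt/\ell}$, $\partial_\rho\phi_k=0$, respectively $\psi_k=0$, $\partial_\rho\psi_k=e^{2\pi i kt/\ell}$. (They are of the form $\Phi_k(\rho)e^{2\pi i kt/\ell}$ with $\Phi_k$ solving $\bigl(-\frac1{\cosh\rho}\frac{d}{d\rho}\cosh\rho\frac{d}{d\rho}+\frac{4\pi^2k^2}{\ell^2\cosh^2\rho}-\lambda\bigr)\Phi_k=0$.) The truncation is $f^{(N)}=\sum_{|k|\le N}(a_k\phi_k+b_k\psi_k)$. The $C^1$-norm on $Z^L_\ell$ is $\|f\|_{C^1}^2=\|f\|_{L^\infty}^2+\|\frac1{\cosh\rho}\partial_tf\|_{L^\infty}^2+\|\partial_\rho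 f\|_{L^\infty}^2$. The function $\mathrm{arccot}$ takes values in $(0,\pi/2]$ on $[0,\infty)$. *)

theory Defs
  imports "HOL-Probability.Essential_Supremum"
begin

section \<open>Functions on the hyperbolic cylinder\<close>

text \<open>
  Functions on \<open>Z\<^sub>l\<close> are represented by their lifts: functions on the upper half plane that are
  invariant under \<open>z \<mapsto> e\<^sup>l z\<close>. Lifts are total functions on \<^typ>\<open>complex\<close>, but only their values on
  \<open>upper_half_plane\<close> matter. The plane \<^typ>\<open>complex\<close> is used as a real vector space, so all derivatives
  are real ones.
\<close>

definition upper_half_plane :: "complex set" where
  "upper_half_plane = {z. Im z > 0}"

definition dir_deriv :: "'a::real_normed_vector \<Rightarrow> ('a \<Rightarrow> 'b::real_normed_vector) \<Rightarrow> 'a \<Rightarrow> 'b" where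
  "dir_deriv v f = (\<lambda>x. frechet_derivative f (at x) v)"

text \<open>\<open>Ck_on n S f\<close> says that \<open>f\<close> is \<open>n\<close> times continuously differentiable on the open set \<open>S\<close>.\<close>

primrec Ck_on :: "nat \<Rightarrow> 'a::real_normed_vector set \<Rightarrow> ('a \<Rightarrow> 'b::real_normed_vector) \<Rightarrow> bool" where
  "Ck_on 0 S f \<longleftrightarrow> continuous_on S f"
| "Ck_on (Suc n) S f \<longleftrightarrow>
     (\<forall>x\<in>S. f differentiable (at x)) \<and> (\<forall>v. Ck_on n S (dir_deriv v f))"

definition smooth_on :: "'a::real_normed_vector set \<Rightarrow> ('a \<Rightarrow> 'b::real_normed_vector) \<Rightarrow> bool" where
  "smooth_on S f \<longleftrightarrow> (\<forall>n. Ck_on n S f)"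

text \<open>The positive Laplacian \<open>- y\<^sup>2 (\<partial>\<^sub>x\<^sup>2 + \<partial>\<^sub>y\<^sup>2)\<close> of the metric \<open>y\<^sup>-\<^sup>2 (dx\<^sup>2 + dy\<^sup>2)\<close>.\<close>

definition hyp_laplacian :: "(complex \<Rightarrow> complex) \<Rightarrow> complex \<Rightarrow> complex" where
  "hyp_laplacian f z =
     - of_real ((Im z)\<^sup>2) * (dir_deriv 1 (dir_deriv 1 f) z + dir_deriv \<i> (dir_deriv \<i> f) z)"

definition eigenspace :: "real \<Rightarrow> real \<Rightarrow> (complex \<Rightarrow> complex) set" where
  "eigenspace l lam = {f.
     (\<forall>z\<in>upper_half_plane. f (of_real (exp l) * z) = f z) \<and>
     smooth_on upper_half_plane f \<and>
     (\<forall>z\<in>upper_half_plane. hyp_laplacian f z - of_real lam * f z = 0)}"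


section \<open>Fermi coordinates\<close>

definition fermi :: "real \<times> real \<Rightarrow> complex" where
  "fermi = (\<lambda>(\<rho>, t). of_real (exp t) * Complex (tanh \<rho>) (1 / cosh \<rho>))"

definition partial_rho :: "(real \<times> real \<Rightarrow> complex) \<Rightarrow> real \<times> real \<Rightarrow> complex" where
  "partial_rho u = (\<lambda>(\<rho>, t). vector_derivative (\<lambda>s. u (s, t)) (at \<rho>))"

definition partial_t :: "(real \<times> real \<Rightarrow> complex) \<Rightarrow> real \<times> real \<Rightarrow> complex" where
  "partial_t u = (\<lambda>(\<rho>, t). vector_derivative (\<lambda>s. u (\<rho>, s)) (at t))"

text \<open>
  In Fermi coordinates the metric is \<open>d\<rho>\<^sup>2 + cosh\<^sup>2 \<rho> dt\<^sup>2\<close>, with area element \<open>cosh \<rho> d\<rho> dt\<close>.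
  The circle \<open>\<real> / l\<int>\<close> is represented by the fundamental domain \<open>0 \<le> t < l\<close>. The set \<open>I\<close> of
  values of \<open>\<rho>\<close> is \<^term>\<open>UNIV\<close> for \<open>Z\<^sub>l\<close> and \<^term>\<open>{-L..L}\<close> for \<open>Z\<^sub>l\<^sup>L\<close>.
\<close>

definition cyl_area :: "real \<Rightarrow> real set \<Rightarrow> (real \<times> real) measure" where
  "cyl_area l I = restrict_space (density lborel (\<lambda>(\<rho>, t). ennreal (cosh \<rho>))) (I \<times> {0..<l})"

definition Linf_norm :: "real \<Rightarrow> real set \<Rightarrow> (real \<times> real \<Rightarrow> complex) \<Rightarrow> real" where
  "Linf_norm l I u = real_of_ereal (esssup (cyl_area l I) (\<lambda>p. ereal (norm (u p))))"

definition C1_norm :: "real \<Rightarrow> real set \<Rightarrow> (real \<times> real \<Rightarrow> complex) \<Rightarrow> real" where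
  "C1_norm l I u = sqrt (
      (Linf_norm l I u)\<^sup>2
    + (Linf_norm l I (\<lambda>(\<rho>, t). of_real (1 / cosh \<rho>) * partial_t u (\<rho>, t)))\<^sup>2
    + (Linf_norm l I (partial_rho u))\<^sup>2)"


section \<open>Fourier expansion\<close>

definition is_phi_mode :: "real \<Rightarrow> real \<Rightarrow> int \<Rightarrow> (complex \<Rightarrow> complex) \<Rightarrow> bool" where
  "is_phi_mode l lam k u \<longleftrightarrow> u \<in> eigenspace l lam \<and>
     (\<forall>t. u (fermi (0, t)) = exp (2 * of_real pi * \<i> * of_int k * of_real t / of_real l)) \<and>
     (\<forall>t. partial_rho (u \<circ> fermi) (0, t) = 0)"

definition is_psi_mode :: "real \<Rightarrow> real \<Rightarrow> int \<Rightarrow> (complex \<Rightarrow> complex) \<Rightarrow> bool" where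
  "is_psi_mode l lam k u \<longleftrightarrow> u \<in> eigenspace l lam \<and>
     (\<forall>t. u (fermi (0, t)) = 0) \<and>
     (\<forall>t. partial_rho (u \<circ> fermi) (0, t) = exp (2 * of_real pi * \<i> * of_int k * of_real t / of_real l))"

text \<open>The pair \<open>(a, b)\<close> of coefficient families with \<open>f = \<Sum>\<^sub>k (a\<^sub>k \<phi>\<^sub>k + b\<^sub>k \<psi>\<^sub>k)\<close>; the two modes of equal
  frequency are grouped into one term, and the sum converges absolutely at each point.\<close>

definition fourier_coeffs ::
  "(int \<Rightarrow> complex \<Rightarrow> complex) \<Rightarrow> (int \<Rightarrow> complex \<Rightarrow> complex) \<Rightarrow> (complex \<Rightarrow> complex)
     \<Rightarrow> (int \<Rightarrow> complex) \<times> (int \<Rightarrow> complex)" where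
  "fourier_coeffs \<phi> \<psi> f = (THE (a, b). \<forall>z\<in>upper_half_plane.
     ((\<lambda>k. a k * \<phi> k z + b k * \<psi> k z) has_sum f z) UNIV)"

definition truncation ::
  "(int \<Rightarrow> complex \<Rightarrow> complex) \<Rightarrow> (int \<Rightarrow> complex \<Rightarrow> complex) \<Rightarrow> nat \<Rightarrow> (complex \<Rightarrow> complex)
     \<Rightarrow> complex \<Rightarrow> complex" where
  "truncation \<phi> \<psi> N f = (\<lambda>z. case fourier_coeffs \<phi> \<psi> f of (a, b) \<Rightarrow>
     (\<Sum>k\<in>{- int N..int N}. a k * \<phi> k z + b k * \<psi> k z))"


section \<open>The constants in the estimate\<close>

text \<open>The branch of the inverse cotangent with values in \<open>(0, \<pi>)\<close>.\<close>

definition arccot :: "real \<Rightarrow> real" where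
  "arccot x = (THE y. 0 < y \<and> y < pi \<and> cot y = x)"

definition ck :: "real \<Rightarrow> real \<Rightarrow> nat \<Rightarrow> real \<Rightarrow> real" where
  "ck l lam k \<phi> =
     2 * pi * real k / l *
       arccos ((2 * pi * real k / l * sin \<phi>) / sqrt (4 * pi\<^sup>2 * (real k)\<^sup>2 / l\<^sup>2 - lam))
     - sqrt lam *
       arccot (sqrt lam * sin \<phi> / sqrt (4 * pi\<^sup>2 * (real k)\<^sup>2 / l\<^sup>2 * (cos \<phi>)\<^sup>2 - lam))"

definition A1 :: "real \<Rightarrow> real \<Rightarrow> real \<Rightarrow> nat \<Rightarrow> real" where
  "A1 l lam \<phi>0 N = 4 * (\<Sum>j. let k = N + 1 + j in 1 / cosh (ck l lam k \<phi>0))"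

definition A2 :: "real \<Rightarrow> real \<Rightarrow> real \<Rightarrow> nat \<Rightarrow> real" where
  "A2 l lam \<phi>0 N = 4 * (\<Sum>j. let k = N + 1 + j in
     2 * pi * real k / l * (1 / cosh (ck l lam k \<phi>0)))"

definition A3 :: "real \<Rightarrow> real \<Rightarrow> real \<Rightarrow> nat \<Rightarrow> real" where
  "A3 l lam \<phi>0 N = 4 * (\<Sum>j. let k = N + 1 + j in
     sqrt (4 * pi\<^sup>2 * (real k)\<^sup>2 / l\<^sup>2 - lam / (cos \<phi>0)\<^sup>2) * (1 / sinh (ck l lam k \<phi>0)))"

definition beta_tilde :: "real \<Rightarrow> real \<Rightarrow> real \<Rightarrow> nat \<Rightarrow> real" where
  "beta_tilde l lam \<phi>0 N = A1 l lam \<phi>0 N"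

definition beta :: "real \<Rightarrow> real \<Rightarrow> real \<Rightarrow> nat \<Rightarrow> real" where
  "beta l lam \<phi>0 N = sqrt ((A1 l lam \<phi>0 N)\<^sup>2 + (A2 l lam \<phi>0 N)\<^sup>2 + (A3 l lam \<phi>0 N)\<^sup>2)"

end

theory Submission
  imports Defs
begin

text \<open>
  Each Fourier coefficient \<open>F(\<rho>)\<close> of a bounded eigenfunction solves, with \<open>P = cosh \<rho> F'\<close> and
  \<open>kap = 2 \<pi> |k| / l\<close>, the system \<open>F' = P / cosh \<rho>\<close>, \<open>P' = (kap\<^sup>2 - lam cosh\<^sup>2 \<rho>) F / cosh \<rho>\<close> and is bounded by
  \<open>M = \<parallel>f\<parallel>\<^sub>\<infinity>\<close>. An even or odd solution grows on the interval where \<open>lam cosh\<^sup>2 \<rho> < kap\<^sup>2\<close>, at least like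
  \<open>cosh\<close> of a WKB phase \<open>c\<close> with \<open>c' = - sqrt (kap\<^sup>2 - lam cosh\<^sup>2 \<rho>) / cosh \<rho>\<close> that vanishes at the turning
  point. As it is at most \<open>M\<close> there, \<open>|F|\<close> is at most \<open>M / cosh c\<close> further inside, and \<open>c = ck\<close> at \<open>\<rho> = L\<close>.
  The even and odd parts of the coefficients of index \<open>k\<close> and \<open>- k\<close> account for the factor 4, and summation
  over \<open>k > N\<close> gives the estimates.
\<close>

section \<open>The radial equation\<close>

text \<open>Two obstacles shape the radial estimate. The factor \<open>1 / q\<close>, with
  \<open>q\<close> the square root in the derivative of the phase, blows up at the turning point; so
  the estimate is made up to some \<open>T\<close> before it, and then \<open>T\<close> tends to it.
  Moreover the estimate must start from \<open>F \<bullet> P = 0\<close> at rho = 0, which even and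
  odd solutions satisfy but others in general do not; hence the splitting, whose parts inherit the
  bound \<open>M\<close>. The Lyapunov function comes from freezing \<open>q\<close>: for constant
  \<open>q\<close> one has exactly F(T) = F(r) cosh u + (P(r) / q) sinh u, so \<open>S\<close> is
  the squared norm of the value at \<open>T\<close> predicted from \<open>r\<close>, and it
  increases to the true one. Its three terms are nonnegative: keeping the first gives the
  \<open>cosh\<close> in \<open>A1\<close> and \<open>A2\<close>, keeping the last the
  \<open>sinh\<close> in \<open>A3\<close>. The modes and the coefficients of the expansion are
  given by characterizations instead of formulas; completeness of the exponentials on the circle
  identifies them.\<close>

lemma arccot_eq_arccos: "arccot x = arccos (x / sqrt (1 + x\<^sup>2))"
proof -
  let ?y = "pi / 2 - arctan x"
  have b: "0 < ?y" "?y < pi" using arctan_bounded[of x] by auto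
  have cs: "cos ?y = x / sqrt (1 + x\<^sup>2)" "sin ?y = 1 / sqrt (1 + x\<^sup>2)"
    by (simp_all add: sin_arctan cos_arctan cos_diff sin_diff)
  have "sqrt (1 + x\<^sup>2) > 0" by (simp add: add_pos_nonneg)
  then have ct: "cot ?y = x" using cs by (simp add: cot_def)
  have "arccot x = ?y" unfolding arccot_def
  proof (rule the_equality)
    show "0 < ?y \<and> ?y < pi \<and> cot ?y = x" using b ct by simp
  next
    fix y assume y: "0 < y \<and> y < pi \<and> cot y = x"
    then have s: "sin y > 0" by (simp add: sin_gt_zero)
    then have "sin (pi / 2 - y) / cos (pi / 2 - y) = x" using y by (simp add: cot_def sin_diff cos_diff)
    then have "tan (pi / 2 - y) = x" by (simp add: tan_def)
    then have "arctan x = pi / 2 - y" using y by (intro arctan_unique) auto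
    then show "y = ?y" by simp
  qed
  also have "?y = arccos (cos ?y)" using b by (simp add: arccos_cos)
  finally show ?thesis using cs by simp
qed

text \<open>In \<open>ck\<close>, \<open>arccot (sqrt lam sin \<phi> / sqrt (kap\<^sup>2 cos\<^sup>2 \<phi> - lam))\<close> equals the second arc cosine here, which
  stays continuous up to the turning point \<open>lam cosh\<^sup>2 r = kap\<^sup>2\<close>, where the whole expression vanishes.\<close>

definition phase :: "real \<Rightarrow> real \<Rightarrow> real \<Rightarrow> real" where
  "phase kap lam r = kap * arccos (kap * tanh r / sqrt (kap\<^sup>2 - lam))
     - sqrt lam * arccos (sqrt lam * sinh r / sqrt (kap\<^sup>2 - lam))"

text \<open>After squaring, both bounds become the last hypothesis, by the identity between
  \<open>cosh\<close> and \<open>sinh\<close>. Strictness keeps the arc cosines in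
  \<open>phase\<close> away from the end points, where they are not differentiable.\<close>

lemma phase_args_bound:
  fixes kap lam r :: real
  assumes "lam > 0" "kap > 0" "lam * (cosh r)\<^sup>2 < kap\<^sup>2"
  shows "lam < kap\<^sup>2" "\<bar>kap * tanh r / sqrt (kap\<^sup>2 - lam)\<bar> < 1"
    "\<bar>sqrt lam * sinh r / sqrt (kap\<^sup>2 - lam)\<bar> < 1"
proof -
  have "1 \<le> (cosh r)\<^sup>2" using cosh_real_ge_1[of r] by (simp add: one_le_power)
  then have "lam * 1 \<le> lam * (cosh r)\<^sup>2" using assms(1) by (intro mult_left_mono) auto
  with assms(3) show lk: "lam < kap\<^sup>2" by simp
  have "lam * (sinh r)\<^sup>2 < kap\<^sup>2 - lam" using assms(3) by (simp add: cosh_square_eq algebra_simps)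
  then have "(sqrt lam * sinh r)\<^sup>2 < (sqrt (kap\<^sup>2 - lam))\<^sup>2" using lk assms(1) by (simp add: power_mult_distrib)
  then have "\<bar>sqrt lam * sinh r\<bar> < sqrt (kap\<^sup>2 - lam)"
    using lk by (metis abs_le_square_iff abs_of_nonneg linorder_not_le real_sqrt_ge_zero diff_ge_0_iff_ge less_imp_le)
  then show "\<bar>sqrt lam * sinh r / sqrt (kap\<^sup>2 - lam)\<bar> < 1" using lk by (simp add: abs_mult)
  have c: "cosh r > 0" by simp
  have "(kap * tanh r)\<^sup>2 * (cosh r)\<^sup>2 = kap\<^sup>2 * ((cosh r)\<^sup>2 - 1)"
    using c by (simp add: tanh_def power_mult_distrib power_divide sinh_square_eq)
  also have "\<dots> < (kap\<^sup>2 - lam) * (cosh r)\<^sup>2" using assms(3) by (simp add: algebra_simps)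
  finally have "(kap * tanh r)\<^sup>2 < (sqrt (kap\<^sup>2 - lam))\<^sup>2" using lk c by simp
  then have "\<bar>kap * tanh r\<bar> < sqrt (kap\<^sup>2 - lam)"
    using lk by (metis abs_le_square_iff abs_of_nonneg linorder_not_le real_sqrt_ge_zero diff_ge_0_iff_ge less_imp_le)
  then show "\<bar>kap * tanh r / sqrt (kap\<^sup>2 - lam)\<bar> < 1" using lk by (simp add: abs_mult)
qed

text \<open>The angle \<open>\<phi>0\<close> is the Gudermannian of \<open>L\<close>: its cosine is
  \<open>1 / cosh L\<close> and its sine is \<open>tanh L\<close>. This carries the trigonometric
  arguments of \<open>ck\<close> into the hyperbolic ones of \<open>phase\<close>.\<close>

lemma ck_eq_phase:
  assumes "l > 0" "lam > 0" "k > 0" "lam * (cosh L)\<^sup>2 < (2 * pi * real k / l)\<^sup>2"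
    and "\<phi>0 = 2 * arctan (tanh (L / 2))"
  shows "ck l lam k \<phi>0 = phase (2 * pi * real k / l) lam L" "cos \<phi>0 = 1 / cosh L"
proof -
  define kap where "kap = 2 * pi * real k / l"
  have kap: "kap > 0" using assms by (simp add: kap_def)
  have k2: "4 * pi\<^sup>2 * (real k)\<^sup>2 / l\<^sup>2 = kap\<^sup>2" by (simp add: kap_def power_divide power_mult_distrib)
  have lc: "lam * (cosh L)\<^sup>2 < kap\<^sup>2" using assms(4) by (simp add: kap_def)
  have lk: "lam < kap\<^sup>2" using phase_args_bound(1)[OF assms(2) kap lc] .
  \<comment> \<open>\<open>cosh L\<close>, \<open>sinh L\<close> and the tangent of half of
    \<open>\<phi>0\<close> are all rational in these two half-argument values.\<close>
  define c s where "c = cosh (L / 2)" and "s = sinh (L / 2)"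
  have cp: "c > 0" by (simp add: c_def)
  have c2: "c\<^sup>2 = s\<^sup>2 + 1" by (simp add: c_def s_def cosh_square_eq)
  have chL: "cosh L = c\<^sup>2 + s\<^sup>2" using cosh_double[of "L/2"] by (simp add: c_def s_def)
  have shL: "sinh L = 2 * s * c" using sinh_double[of "L/2"] by (simp add: c_def s_def)
  have th: "tanh (L / 2) = s / c" by (simp add: tanh_def c_def s_def)
  define a where "a = arctan (tanh (L / 2))"
  have ca: "(cos a)\<^sup>2 = c\<^sup>2 / (c\<^sup>2 + s\<^sup>2)"
  proof -
    have "1 + (s / c)\<^sup>2 > 0" by (simp add: add_pos_nonneg)
    then have "(cos a)\<^sup>2 = 1 / (1 + (s / c)\<^sup>2)" by (simp add: a_def th cos_arctan power_divide)
    also have "1 + (s / c)\<^sup>2 = (c\<^sup>2 + s\<^sup>2) / c\<^sup>2" using cp by (simp add: field_simps power2_eq_square)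
    finally show ?thesis by simp
  qed
  have ta: "tan a = s / c" by (simp add: a_def th tan_arctan)
  have cosa: "cos a > 0" unfolding a_def by (simp add: cos_arctan add_pos_nonneg)
  then have sa: "sin a = s / c * cos a" using ta by (simp add: tan_def field_simps)
  have p: "c\<^sup>2 + s\<^sup>2 > 0" using cp by (simp add: add_pos_nonneg)
  have "cos \<phi>0 = 2 * (cos a)\<^sup>2 - 1" by (simp add: assms(5) a_def cos_double_cos)
  also have "\<dots> = (c\<^sup>2 - s\<^sup>2) / (c\<^sup>2 + s\<^sup>2)" proof -
    have "2 * (cos a)\<^sup>2 - 1 = (2 * c\<^sup>2 - (c\<^sup>2 + s\<^sup>2)) / (c\<^sup>2 + s\<^sup>2)"
      unfolding ca diff_divide_distrib using less_imp_neq[OF p] by simp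
    then show ?thesis by simp
  qed
  finally show cos: "cos \<phi>0 = 1 / cosh L" using c2 chL by simp
  have "sin \<phi>0 = 2 * sin a * cos a" by (simp add: assms(5) a_def sin_double)
  also have "\<dots> = 2 * (s / c) * (cos a)\<^sup>2" by (simp add: sa power2_eq_square)
  also have "\<dots> = 2 * s * c / (c\<^sup>2 + s\<^sup>2)" using p cp ca by (simp add: power2_eq_square)
  finally have sin: "sin \<phi>0 = tanh L" by (simp add: tanh_def chL shL)
  \<comment> \<open>The denominator inside \<open>arccot\<close>. Its square plus that of the
    numerator is \<open>kap\<^sup>2 - lam\<close> divided by \<open>(cosh L)\<^sup>2\<close>, which
    produces the denominator in \<open>phase\<close>.\<close>
  define D where "D = sqrt (kap\<^sup>2 * (1 / cosh L)\<^sup>2 - lam)"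
  have Dp: "kap\<^sup>2 * (1 / cosh L)\<^sup>2 - lam > 0" using lc by (simp add: power_divide field_simps)
  then have D: "D > 0" "D\<^sup>2 = kap\<^sup>2 / (cosh L)\<^sup>2 - lam" by (simp_all add: D_def power_divide)
  define x where "x = sqrt lam * tanh L / D"
  have "1 + x\<^sup>2 = (D\<^sup>2 + lam * (tanh L)\<^sup>2) / D\<^sup>2" using D(1) assms(2)
    by (simp add: x_def power_divide power_mult_distrib add_divide_distrib)
  also have "D\<^sup>2 + lam * (tanh L)\<^sup>2 = (kap\<^sup>2 - lam) / (cosh L)\<^sup>2"
    unfolding D(2) tanh_def by (simp add: power_divide sinh_square_eq field_simps)
  finally have "sqrt (1 + x\<^sup>2) = sqrt (kap\<^sup>2 - lam) / cosh L / D"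
    using D(1) by (simp add: real_sqrt_divide real_sqrt_mult)
  then have "x / sqrt (1 + x\<^sup>2) = sqrt lam * sinh L / sqrt (kap\<^sup>2 - lam)"
    using D(1) by (simp add: x_def tanh_def)
  then have "arccot x = arccos (sqrt lam * sinh L / sqrt (kap\<^sup>2 - lam))" by (simp add: arccot_eq_arccos)
  then show "ck l lam k \<phi>0 = phase (2 * pi * real k / l) lam L"
    unfolding ck_def phase_def k2 sin cos kap_def[symmetric] D_def[symmetric] x_def[symmetric] by simp
qed

text \<open>Both arc cosine derivatives carry the same factor \<open>1 / q\<close>. Their
  contributions have numerators \<open>- kap\<^sup>2\<close> and
  \<open>lam * (cosh r)\<^sup>2\<close> over \<open>q * cosh r\<close>, which add up to
  \<open>- q\<^sup>2\<close>, so the singularity at \<open>q = 0\<close> cancels.\<close>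

lemma DERIV_phase:
  assumes "lam > 0" "kap > 0" "lam * (cosh r)\<^sup>2 < kap\<^sup>2"
  shows "(phase kap lam has_real_derivative - (sqrt (kap\<^sup>2 - lam * (cosh r)\<^sup>2) / cosh r)) (at r)"
proof -
  note b = phase_args_bound[OF assms]
  define m where "m = sqrt (kap\<^sup>2 - lam)"
  define q where "q = sqrt (kap\<^sup>2 - lam * (cosh r)\<^sup>2)"
  have m: "m > 0" "m\<^sup>2 = kap\<^sup>2 - lam" using b(1) by (simp_all add: m_def)
  have q: "q > 0" "q\<^sup>2 = kap\<^sup>2 - lam * (cosh r)\<^sup>2" using assms(3) by (simp_all add: q_def)
  have "1 - (kap * tanh r / m)\<^sup>2 = (m\<^sup>2 - (kap * tanh r)\<^sup>2) / m\<^sup>2"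
    using m(1) by (simp add: power_divide field_simps)
  also have "m\<^sup>2 - (kap * tanh r)\<^sup>2 = (q / cosh r)\<^sup>2"
    unfolding m(2) power_divide q(2) tanh_def power_mult_distrib
    by (simp add: sinh_square_eq field_simps)
  finally have s1: "sqrt (1 - (kap * tanh r / m)\<^sup>2) = q / cosh r / m"
    using m(1) q(1) by (simp add: real_sqrt_divide)
  have "1 - (sqrt lam * sinh r / m)\<^sup>2 = (m\<^sup>2 - lam * (sinh r)\<^sup>2) / m\<^sup>2"
    using m(1) assms(1) by (simp add: power_divide power_mult_distrib field_simps)
  also have "m\<^sup>2 - lam * (sinh r)\<^sup>2 = q\<^sup>2" unfolding m(2) q(2) by (simp add: sinh_square_eq algebra_simps)
  finally have s2: "sqrt (1 - (sqrt lam * sinh r / m)\<^sup>2) = q / m"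
    using m(1) q(1) by (simp add: real_sqrt_divide)
  have b1: "- 1 < kap * tanh r / m" "kap * tanh r / m < 1" using b(2) unfolding m_def by linarith+
  have b2: "- 1 < sqrt lam * sinh r / m" "sqrt lam * sinh r / m < 1" using b(3) unfolding m_def by linarith+
  have t2: "1 - (tanh r)\<^sup>2 = 1 / (cosh r)\<^sup>2" by (simp add: tanh_def power_divide sinh_square_eq field_simps)
  have "((\<lambda>r. kap * tanh r / m) has_real_derivative kap / (cosh r)\<^sup>2 / m) (at r)"
    using m(1) by (auto intro!: derivative_eq_intros simp: t2)
  from DERIV_chain2[OF DERIV_arccos[OF b1] this]
  have d1: "((\<lambda>r. arccos (kap * tanh r / m)) has_real_derivative - (kap / (q * cosh r))) (at r)"
    unfolding s1 using m(1) q(1) by (simp add: field_simps power2_eq_square)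
  have "((\<lambda>r. sqrt lam * sinh r / m) has_real_derivative sqrt lam * cosh r / m) (at r)"
    using m(1) by (auto intro!: derivative_eq_intros)
  from DERIV_chain2[OF DERIV_arccos[OF b2] this]
  have d2: "((\<lambda>r. arccos (sqrt lam * sinh r / m)) has_real_derivative - (sqrt lam * cosh r / q)) (at r)"
    unfolding s2 using m(1) q(1) by (simp add: field_simps)
  have "((\<lambda>r. kap * arccos (kap * tanh r / m) - sqrt lam * arccos (sqrt lam * sinh r / m))
      has_real_derivative kap * - (kap / (q * cosh r)) - sqrt lam * - (sqrt lam * cosh r / q)) (at r)"
    by (intro DERIV_diff DERIV_cmult d1 d2)
  also have "kap * - (kap / (q * cosh r)) - sqrt lam * - (sqrt lam * cosh r / q) = - (q\<^sup>2 / (q * cosh r))"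
    unfolding q(2) using q(1) assms(1)
    by (simp add: field_simps power2_eq_square)
  also have "\<dots> = - (q / cosh r)" using q(1) by (simp add: power2_eq_square)
  finally show ?thesis unfolding phase_def[abs_def] m_def q_def .
qed

text \<open>Both arc cosines have argument 1 at \<open>R\<close>. \<open>DERIV_phase\<close> stops
  short of \<open>R\<close>, so continuity up to \<open>R\<close> is recorded in order to get there
  by a limit.\<close>

lemma turning_point:
  fixes kap lam L :: real
  assumes "lam > 0" "kap > 0" "0 \<le> L" "lam * (cosh L)\<^sup>2 < kap\<^sup>2"
  obtains R where "L < R" "lam * (cosh R)\<^sup>2 = kap\<^sup>2" "\<And>r. 0 \<le> r \<Longrightarrow> r < R \<Longrightarrow> lam * (cosh r)\<^sup>2 < kap\<^sup>2"
    "phase kap lam R = 0" "continuous_on {0..R} (phase kap lam)"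
proof -
  define R where "R = arcosh (kap / sqrt lam)"
  have "(sqrt lam * cosh L)\<^sup>2 < kap\<^sup>2" using assms by (simp add: power_mult_distrib)
  then have "sqrt lam * cosh L < kap" using assms(2) by (simp add: power2_less_imp_less)
  then have c: "cosh L < kap / sqrt lam" using assms(1) by (simp add: field_simps)
  then have g: "1 \<le> kap / sqrt lam" using cosh_real_ge_1[of L] by linarith
  then have cR: "cosh R = kap / sqrt lam" by (simp add: R_def)
  have R0: "R \<ge> 0" using g by (simp add: R_def)
  have LR: "L < R" using c cR R0 assms(3) by (metis cosh_real_nonneg_less_iff)
  have cR2: "lam * (cosh R)\<^sup>2 = kap\<^sup>2" using assms(1) by (simp add: cR power_divide)
  have less: "lam * (cosh r)\<^sup>2 < kap\<^sup>2" if "0 \<le> r" "r < R" for r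
  proof -
    have "cosh r < cosh R" using that by (simp add: cosh_real_nonneg_less_iff)
    then have "(cosh r)\<^sup>2 < (cosh R)\<^sup>2" by (intro power_strict_mono) auto
    then show ?thesis using assms(1) cR2 by (metis mult_strict_left_mono)
  qed
  have lk: "lam < kap\<^sup>2" using phase_args_bound(1)[OF assms(1,2,4)] .
  have Rp: "R > 0" using LR assms(3) by simp
  have sR: "sinh R > 0" using Rp by simp
  have m2: "(sqrt lam * sinh R)\<^sup>2 = kap\<^sup>2 - lam"
    using cR2 assms(1) by (simp add: power_mult_distrib sinh_square_eq algebra_simps)
  have m: "sqrt (kap\<^sup>2 - lam) = sqrt lam * sinh R"
    using m2 sR assms(1) by (metis real_sqrt_unique less_imp_le mult_nonneg_nonneg real_sqrt_ge_zero)
  have "kap = sqrt lam * cosh R" using cR assms(1) by simp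
  then have e1: "kap * tanh R / sqrt (kap\<^sup>2 - lam) = 1" unfolding m using sR assms(1) by (simp add: tanh_def)
  have e2: "sqrt lam * sinh R / sqrt (kap\<^sup>2 - lam) = 1" unfolding m using sR assms(1) by simp
  have b: "\<bar>kap * tanh r / sqrt (kap\<^sup>2 - lam)\<bar> \<le> 1 \<and> \<bar>sqrt lam * sinh r / sqrt (kap\<^sup>2 - lam)\<bar> \<le> 1"
    if "0 \<le> r" "r \<le> R" for r
  proof (cases "r = R")
    case True then show ?thesis using e1 e2 by simp
  next
    case False
    then have "lam * (cosh r)\<^sup>2 < kap\<^sup>2" using that less by simp
    from phase_args_bound[OF assms(1,2) this] show ?thesis by linarith
  qed
  have ab: "- 1 \<le> x \<and> x \<le> 1" if "\<bar>x\<bar> \<le> 1" for x :: real using that by linarith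
  show ?thesis
  proof (rule that[OF LR cR2 less])
    show "phase kap lam R = 0" unfolding phase_def e1 e2 by simp
    have 1: "continuous_on {0..R} (\<lambda>r. arccos (kap * tanh r / sqrt (kap\<^sup>2 - lam)))"
    proof (rule continuous_on_arccos)
      show "continuous_on {0..R} (\<lambda>r. kap * tanh r / sqrt (kap\<^sup>2 - lam))"
        using lk by (intro continuous_intros) auto
      show "\<forall>r\<in>{0..R}. - 1 \<le> kap * tanh r / sqrt (kap\<^sup>2 - lam) \<and> kap * tanh r / sqrt (kap\<^sup>2 - lam) \<le> 1"
      proof
        fix r assume "r \<in> {0..R}"
        then show "- 1 \<le> kap * tanh r / sqrt (kap\<^sup>2 - lam) \<and> kap * tanh r / sqrt (kap\<^sup>2 - lam) \<le> 1"
          using b[of r] by (intro ab) simp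
      qed
    qed
    have 2: "continuous_on {0..R} (\<lambda>r. arccos (sqrt lam * sinh r / sqrt (kap\<^sup>2 - lam)))"
    proof (rule continuous_on_arccos)
      show "continuous_on {0..R} (\<lambda>r. sqrt lam * sinh r / sqrt (kap\<^sup>2 - lam))"
        using lk by (intro continuous_intros) auto
      show "\<forall>r\<in>{0..R}. - 1 \<le> sqrt lam * sinh r / sqrt (kap\<^sup>2 - lam) \<and> sqrt lam * sinh r / sqrt (kap\<^sup>2 - lam) \<le> 1"
      proof
        fix r assume "r \<in> {0..R}"
        then show "- 1 \<le> sqrt lam * sinh r / sqrt (kap\<^sup>2 - lam) \<and> sqrt lam * sinh r / sqrt (kap\<^sup>2 - lam) \<le> 1"
          using b[of r] by (intro ab) simp
      qed
    qed
    show "continuous_on {0..R} (phase kap lam)" unfolding phase_def[abs_def]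
      by (intro continuous_intros 1 2)
  qed
qed

section \<open>Growth of solutions before the turning point\<close>

lemma ode_energy_monotone:
  fixes A B D :: "real \<Rightarrow> real"
  assumes lam: "lam > 0" and kap: "kap > 0"
    and ok: "\<And>r. 0 \<le> r \<Longrightarrow> r \<le> T \<Longrightarrow> lam * (cosh r)\<^sup>2 < kap\<^sup>2"
    and dA: "\<And>r. (A has_real_derivative 2 * B r / cosh r) (at r)"
    and dB: "\<And>r. (B has_real_derivative (D r + (kap\<^sup>2 - lam * (cosh r)\<^sup>2) * A r) / cosh r) (at r)"
    and dD: "\<And>r. (D has_real_derivative 2 * (kap\<^sup>2 - lam * (cosh r)\<^sup>2) * B r / cosh r) (at r)"
    and pos: "\<And>r. 0 \<le> A r" "\<And>r. 0 \<le> D r" and B0: "B 0 = 0"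
    and r: "0 \<le> r" "r \<le> r'" "r' \<le> T"
  shows "0 \<le> B r" "A r \<le> A r'" "D r \<le> D r'"
proof -
  have ok': "0 < kap\<^sup>2 - lam * (cosh r)\<^sup>2" if "0 \<le> r" "r \<le> T" for r using ok[OF that] by simp
  \<comment> \<open>\<open>A\<close>, \<open>B\<close>, \<open>D\<close> will be |F|^2, the inner
    product of \<open>F\<close> and \<open>P\<close>, and |P|^2. The condition
    \<open>B 0 = 0\<close> encodes even or odd initial data; the derivative of \<open>B\<close> is a
    sum of nonnegative terms, and \<open>B\<close> in turn drives \<open>A\<close> and
    \<open>D\<close> upwards.\<close>
  have B: "0 \<le> B r" if "0 \<le> r" "r \<le> T" for r
  proof -
    have "B 0 \<le> B r"
    proof (rule DERIV_nonneg_imp_nondecreasing[OF that(1)])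
      fix x assume x: "0 \<le> x" "x \<le> r"
      have "0 \<le> (D x + (kap\<^sup>2 - lam * (cosh x)\<^sup>2) * A x) / cosh x"
        using pos[of x] ok'[of x] x that by (intro divide_nonneg_nonneg add_nonneg_nonneg mult_nonneg_nonneg) auto
      then show "\<exists>y. (B has_real_derivative y) (at x) \<and> 0 \<le> y" using dB by blast
    qed
    then show ?thesis using B0 by simp
  qed
  show "0 \<le> B r" using B r by simp
  show "A r \<le> A r'"
  proof (rule DERIV_nonneg_imp_nondecreasing[OF r(2)])
    fix x assume x: "r \<le> x" "x \<le> r'"
    have "0 \<le> 2 * B x / cosh x" using B[of x] x r by simp
    then show "\<exists>y. (A has_real_derivative y) (at x) \<and> 0 \<le> y" using dA by blast
  qed
  show "D r \<le> D r'"
  proof (rule DERIV_nonneg_imp_nondecreasing[OF r(2)])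
    fix x assume x: "r \<le> x" "x \<le> r'"
    have "0 \<le> 2 * (kap\<^sup>2 - lam * (cosh x)\<^sup>2) * B x / cosh x" using B[of x] ok'[of x] x r by simp
    then show "\<exists>y. (D has_real_derivative y) (at x) \<and> 0 \<le> y" using dD by blast
  qed
qed

text \<open>Product and quotient rule for the Lyapunov function with abstract factors:
  \<open>c\<close> and \<open>s\<close> will be \<open>cosh\<close> and \<open>sinh\<close> of a
  phase difference. The terms with \<open>q'\<close> are kept apart since they alone survive the
  later cancellation.\<close>

lemma lyapunov_derivative:
  fixes A B D c s q :: "real \<Rightarrow> real"
  assumes "(A has_real_derivative a) (at x)" "(B has_real_derivative b) (at x)"
    "(D has_real_derivative d) (at x)" "(c has_real_derivative c') (at x)"
    "(s has_real_derivative s') (at x)" "(q has_real_derivative q') (at x)" "q x \<noteq> 0"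
  shows "((\<lambda>x. A x * (c x)\<^sup>2 + 2 * B x * c x * s x / q x + D x * (s x)\<^sup>2 / (q x)\<^sup>2) has_real_derivative
      a * (c x)\<^sup>2 + A x * (2 * c x * c')
    + (2 * b * c x * s x + 2 * B x * c' * s x + 2 * B x * c x * s') / q x
    - 2 * B x * c x * s x * q' / (q x)\<^sup>2
    + (d * (s x)\<^sup>2 + D x * (2 * s x * s')) / (q x)\<^sup>2 - D x * (s x)\<^sup>2 * (2 * q') / (q x)^3) (at x)"
  by (rule derivative_eq_intros assms refl | simp add: assms)+
     (use assms(7) in \<open>simp add: field_simps power2_eq_square power3_eq_cube power4_eq_xxxx\<close>)

text \<open>The Lyapunov function \<open>S\<close> is the squared norm of \<open>F cosh u + (P / q) sinh u\<close>, where
  \<open>u = phase r - phase T\<close>; the derivatives of the hyperbolic factors cancel against the equation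
  for \<open>(F, P)\<close>, and only the contribution of \<open>1 / q\<close>, which increases, is left.\<close>

lemma ode_phase_bound:
  fixes A B D :: "real \<Rightarrow> real"
  assumes lam: "lam > 0" and kap: "kap > 0"
    and ok: "\<And>r. 0 \<le> r \<Longrightarrow> r \<le> T \<Longrightarrow> lam * (cosh r)\<^sup>2 < kap\<^sup>2"
    and dA: "\<And>r. (A has_real_derivative 2 * B r / cosh r) (at r)"
    and dB: "\<And>r. (B has_real_derivative (D r + (kap\<^sup>2 - lam * (cosh r)\<^sup>2) * A r) / cosh r) (at r)"
    and dD: "\<And>r. (D has_real_derivative 2 * (kap\<^sup>2 - lam * (cosh r)\<^sup>2) * B r / cosh r) (at r)"
    and pos: "\<And>r. 0 \<le> A r" "\<And>r. 0 \<le> D r" and B0: "B 0 = 0"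
    and r: "0 \<le> r" "r \<le> T"
  shows "A r * (cosh (phase kap lam r - phase kap lam T))\<^sup>2 \<le> A T"
    and "D r * (sinh (phase kap lam r - phase kap lam T))\<^sup>2 \<le> A T * (kap\<^sup>2 - lam * (cosh r)\<^sup>2)"
proof -
  define q where "q = (\<lambda>r. sqrt (kap\<^sup>2 - lam * (cosh r)\<^sup>2))"
  define u where "u = (\<lambda>r. phase kap lam r - phase kap lam T)"
  define S where "S = (\<lambda>r. A r * (cosh (u r))\<^sup>2 + 2 * B r * cosh (u r) * sinh (u r) / q r
      + D r * (sinh (u r))\<^sup>2 / (q r)\<^sup>2)"
  have q: "q x > 0" "(q x)\<^sup>2 = kap\<^sup>2 - lam * (cosh x)\<^sup>2" if "0 \<le> x" "x \<le> T" for x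
    using ok[OF that] by (simp_all add: q_def)
  have dq: "(q has_real_derivative - lam * cosh x * sinh x / q x) (at x)" if "0 \<le> x" "x \<le> T" for x
    unfolding q_def using ok[OF that] by (auto intro!: derivative_eq_intros simp: divide_simps)
  have du: "(u has_real_derivative - q x / cosh x) (at x)" if "0 \<le> x" "x \<le> T" for x
    unfolding u_def q_def using DERIV_phase[OF lam kap ok[OF that]] by (auto intro!: derivative_eq_intros)
  have Bn: "0 \<le> B x" if "0 \<le> x" "x \<le> T" for x
    by (rule ode_energy_monotone[OF lam kap ok dA dB dD pos B0 that(1) order_refl that(2)])
  have un: "0 \<le> u x" if "0 \<le> x" "x \<le> T" for x
  proof -
    have "u T \<le> u x"
    proof (rule DERIV_nonpos_imp_nonincreasing[OF that(2)])
      fix y assume y: "x \<le> y" "y \<le> T"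
      have "- q y / cosh y \<le> 0" using q(1)[of y] y that by simp
      then show "\<exists>d. (u has_real_derivative d) (at y) \<and> d \<le> 0" using du[of y] y that by (meson order_trans)
    qed
    then show ?thesis by (simp add: u_def)
  qed
  have "S r \<le> S T"
  proof (rule DERIV_nonneg_imp_nondecreasing[OF r(2)])
    fix x assume x: "r \<le> x" "x \<le> T"
    then have x0: "0 \<le> x" using r by simp
    define ch sh where "ch = cosh (u x)" and "sh = sinh (u x)"
    have nn: "q x \<noteq> 0" using q(1)[OF x0 x(2)] by simp
    have c0: "cosh x \<noteq> 0" by simp
    have dC: "((\<lambda>x. cosh (u x)) has_real_derivative sh * (- q x / cosh x)) (at x)"
      unfolding sh_def using has_field_derivative_cosh[OF du[OF x0 x(2)]] by simp
    have dS: "((\<lambda>x. sinh (u x)) has_real_derivative ch * (- q x / cosh x)) (at x)"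
      unfolding ch_def using has_field_derivative_sinh[OF du[OF x0 x(2)]] by simp
    have "(S has_real_derivative
        2 * B x / cosh x * ch\<^sup>2 + A x * (2 * ch * (sh * (- q x / cosh x)))
      + (2 * ((D x + (q x)\<^sup>2 * A x) / cosh x) * ch * sh + 2 * B x * (sh * (- q x / cosh x)) * sh
         + 2 * B x * ch * (ch * (- q x / cosh x))) / q x
      - 2 * B x * ch * sh * (- lam * cosh x * sinh x / q x) / (q x)\<^sup>2
      + (2 * (q x)\<^sup>2 * B x / cosh x * sh\<^sup>2 + D x * (2 * sh * (ch * (- q x / cosh x)))) / (q x)\<^sup>2
      - D x * sh\<^sup>2 * (2 * (- lam * cosh x * sinh x / q x)) / (q x)^3) (at x)"
      unfolding S_def ch_def sh_def
      by (rule DERIV_cong[OF lyapunov_derivative[OF dA dB dD dC dS dq[OF x0 x(2)] nn]])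
         (simp add: ch_def sh_def q(2)[OF x0 x(2)])
    moreover have "2 * B x / cosh x * ch\<^sup>2 + A x * (2 * ch * (sh * (- q x / cosh x)))
      + (2 * ((D x + (q x)\<^sup>2 * A x) / cosh x) * ch * sh + 2 * B x * (sh * (- q x / cosh x)) * sh
         + 2 * B x * ch * (ch * (- q x / cosh x))) / q x
      - 2 * B x * ch * sh * (- lam * cosh x * sinh x / q x) / (q x)\<^sup>2
      + (2 * (q x)\<^sup>2 * B x / cosh x * sh\<^sup>2 + D x * (2 * sh * (ch * (- q x / cosh x)))) / (q x)\<^sup>2
      - D x * sh\<^sup>2 * (2 * (- lam * cosh x * sinh x / q x)) / (q x)^3
      = 2 * lam * cosh x * sinh x / (q x)^3 * sh * (B x * ch + D x * sh / q x)"
      using nn c0 by (simp add: field_simps power2_eq_square power3_eq_cube)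
    moreover have "0 \<le> 2 * lam * cosh x * sinh x / (q x)^3 * sh * (B x * ch + D x * sh / q x)"
      unfolding ch_def sh_def using lam q(1)[OF x0 x(2)] Bn[OF x0 x(2)] pos(2)[of x] un[OF x0 x(2)] x0
      by (intro mult_nonneg_nonneg add_nonneg_nonneg divide_nonneg_pos zero_less_power) auto
    ultimately show "\<exists>y. (S has_real_derivative y) (at x) \<and> 0 \<le> y" by auto
  qed
  moreover have "S T = A T" by (simp add: S_def u_def)
  moreover have "0 \<le> A r * (cosh (u r))\<^sup>2" "0 \<le> 2 * B r * cosh (u r) * sinh (u r) / q r"
      "0 \<le> D r * (sinh (u r))\<^sup>2 / (q r)\<^sup>2"
    using pos Bn[OF r] un[OF r] q(1)[OF r] by auto
  ultimately have "A r * (cosh (u r))\<^sup>2 \<le> A T" "D r * (sinh (u r))\<^sup>2 / (q r)\<^sup>2 \<le> A T"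
    unfolding S_def by linarith+
  moreover have "(q r)\<^sup>2 > 0" using q(1)[OF r] by simp
  ultimately show "A r * (cosh (phase kap lam r - phase kap lam T))\<^sup>2 \<le> A T"
      "D r * (sinh (phase kap lam r - phase kap lam T))\<^sup>2 \<le> A T * (kap\<^sup>2 - lam * (cosh r)\<^sup>2)"
    unfolding u_def q(2)[OF r, symmetric] by (simp_all add: pos_divide_le_eq)
qed

text \<open>The phase decreases strictly to its zero at the turning point. Positivity allows the
  division by \<open>sinh\<close> in the bounds for \<open>P\<close>.\<close>

lemma phase_pos:
  assumes "lam > 0" "kap > 0" "0 \<le> L" "lam * (cosh L)\<^sup>2 < kap\<^sup>2"
  shows "0 < phase kap lam L"
proof -
  from turning_point[OF assms] obtain R where R: "L < R" "\<And>r. 0 \<le> r \<Longrightarrow> r < R \<Longrightarrow> lam * (cosh r)\<^sup>2 < kap\<^sup>2"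
    "phase kap lam R = 0" "continuous_on {0..R} (phase kap lam)" by metis
  have "phase kap lam R < phase kap lam L"
  proof (rule DERIV_neg_imp_decreasing_open[OF R(1)])
    show "continuous_on {L..R} (phase kap lam)" using R(4) by (rule continuous_on_subset) (use assms in auto)
    fix x assume "L < x" "x < R"
    then have x: "lam * (cosh x)\<^sup>2 < kap\<^sup>2" using R(2)[of x] assms(3) by simp
    then show "\<exists>y. (phase kap lam has_real_derivative y) (at x) \<and> y < 0"
      using DERIV_phase[OF assms(1,2) x] by (intro exI[of _ "- (sqrt (kap\<^sup>2 - lam * (cosh x)\<^sup>2) / cosh x)"]) auto
  qed
  then show ?thesis using R(3) by simp
qed

text \<open>\<open>ode_phase_bound\<close> compares \<open>L\<close> with a later \<open>T\<close>,
  where |F| is at most \<open>M\<close>. As \<open>T\<close> tends to the turning point its phase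
  tends to 0, and only the phase at \<open>L\<close> remains. Boundedness is thus used beyond
  \<open>L\<close>, which is why the norm over the whole cylinder appears in the estimate.\<close>

lemma ode_bound:
  fixes F P :: "real \<Rightarrow> 'a::real_inner"
  assumes lam: "lam > 0" and kap: "kap > 0" and L: "0 \<le> L" "lam * (cosh L)\<^sup>2 < kap\<^sup>2"
    and dF: "\<And>r. (F has_vector_derivative (1 / cosh r) *\<^sub>R P r) (at r)"
    and dP: "\<And>r. (P has_vector_derivative ((kap\<^sup>2 - lam * (cosh r)\<^sup>2) / cosh r) *\<^sub>R F r) (at r)"
    and init: "F 0 = 0 \<or> P 0 = 0"
    and bd: "\<And>r. norm (F r) \<le> M"
    and r: "0 \<le> r" "r \<le> L"
  shows "norm (F r) \<le> M / cosh (phase kap lam L)"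
    and "norm (P r) \<le> M * sqrt (kap\<^sup>2 - lam * (cosh L)\<^sup>2) / sinh (phase kap lam L)"
proof -
  define A B D where "A = (\<lambda>r. F r \<bullet> F r)" and "B = (\<lambda>r. F r \<bullet> P r)" and "D = (\<lambda>r. P r \<bullet> P r)"
  have M0: "M \<ge> 0" using bd[of 0] norm_ge_zero order_trans by blast
  have dF': "(F has_derivative (\<lambda>h. h *\<^sub>R (1 / cosh r) *\<^sub>R P r)) (at r)" for r
    using dF by (simp add: has_vector_derivative_def)
  have dP': "(P has_derivative (\<lambda>h. h *\<^sub>R ((kap\<^sup>2 - lam * (cosh r)\<^sup>2) / cosh r) *\<^sub>R F r)) (at r)" for r
    using dP by (simp add: has_vector_derivative_def)
  have dA: "(A has_real_derivative 2 * B r / cosh r) (at r)" for r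
    unfolding A_def B_def has_field_derivative_def
    by (rule has_derivative_eq_rhs[OF has_derivative_inner[OF dF' dF']])
       (auto simp: fun_eq_iff inner_commute field_simps)
  have dB: "(B has_real_derivative (D r + (kap\<^sup>2 - lam * (cosh r)\<^sup>2) * A r) / cosh r) (at r)" for r
    unfolding A_def B_def D_def has_field_derivative_def
    by (rule has_derivative_eq_rhs[OF has_derivative_inner[OF dF' dP']])
       (auto simp: fun_eq_iff inner_commute field_simps)
  have dD: "(D has_real_derivative 2 * (kap\<^sup>2 - lam * (cosh r)\<^sup>2) * B r / cosh r) (at r)" for r
    unfolding D_def B_def has_field_derivative_def
    by (rule has_derivative_eq_rhs[OF has_derivative_inner[OF dP' dP']])
       (auto simp: fun_eq_iff inner_commute field_simps)
  have pos: "0 \<le> A r" "0 \<le> D r" for r by (simp_all add: A_def D_def)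
  have B0: "B 0 = 0" using init by (auto simp: B_def)
  have AM: "A r \<le> M\<^sup>2" for r
    unfolding A_def by (simp add: power2_norm_eq_inner[symmetric] bd power_mono)
  from turning_point[OF lam kap L] obtain R where R: "L < R" "\<And>r. 0 \<le> r \<Longrightarrow> r < R \<Longrightarrow> lam * (cosh r)\<^sup>2 < kap\<^sup>2"
    "phase kap lam R = 0" "continuous_on {0..R} (phase kap lam)" by metis
  have cont: "((phase kap lam) \<longlongrightarrow> 0) (at_left R)"
  proof -
    have "((phase kap lam) \<longlongrightarrow> phase kap lam R) (at R within {0..R})"
      using R(1,4) L(1) by (auto simp: continuous_on_def)
    moreover have "at R within {0..R} = at_left R" using R(1) L(1) by (intro at_within_Icc_at_left) simp
    ultimately show ?thesis using R(3) by simp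
  qed
  have ev: "\<forall>\<^sub>F T in at_left R. L < T \<and> T < R"
    using eventually_at_left_real[OF R(1)] by (simp add: greaterThanLessThan_iff)
  have evb: "\<forall>\<^sub>F T in at_left R. A L * (cosh (phase kap lam L - phase kap lam T))\<^sup>2 \<le> M\<^sup>2
      \<and> D L * (sinh (phase kap lam L - phase kap lam T))\<^sup>2 \<le> M\<^sup>2 * (kap\<^sup>2 - lam * (cosh L)\<^sup>2)"
    using ev
  proof eventually_elim
    case (elim T)
    have ok: "lam * (cosh x)\<^sup>2 < kap\<^sup>2" if "0 \<le> x" "x \<le> T" for x using R(2)[of x] that elim by simp
    have LT: "L \<le> T" using elim by simp
    note b = ode_phase_bound[OF lam kap ok dA dB dD pos B0 L(1) LT]
    have "A T * (kap\<^sup>2 - lam * (cosh L)\<^sup>2) \<le> M\<^sup>2 * (kap\<^sup>2 - lam * (cosh L)\<^sup>2)"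
      using AM L(2) by (intro mult_right_mono) auto
    then show ?case using b AM[of T] by linarith
  qed
  have t1: "((\<lambda>T. A L * (cosh (phase kap lam L - phase kap lam T))\<^sup>2) \<longlongrightarrow> A L * (cosh (phase kap lam L - 0))\<^sup>2) (at_left R)"
    by (intro tendsto_intros cont)
  have "A L * (cosh (phase kap lam L - 0))\<^sup>2 \<le> M\<^sup>2"
    by (rule tendsto_upperbound[OF t1 eventually_mono[OF evb]]) auto
  then have 1: "A L * (cosh (phase kap lam L))\<^sup>2 \<le> M\<^sup>2" by simp
  have t2: "((\<lambda>T. D L * (sinh (phase kap lam L - phase kap lam T))\<^sup>2) \<longlongrightarrow> D L * (sinh (phase kap lam L - 0))\<^sup>2) (at_left R)"
    by (intro tendsto_intros cont)
  have "D L * (sinh (phase kap lam L - 0))\<^sup>2 \<le> M\<^sup>2 * (kap\<^sup>2 - lam * (cosh L)\<^sup>2)"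
    by (rule tendsto_upperbound[OF t2 eventually_mono[OF evb]]) auto
  then have 2: "D L * (sinh (phase kap lam L))\<^sup>2 \<le> M\<^sup>2 * (kap\<^sup>2 - lam * (cosh L)\<^sup>2)" by simp
  have ok: "lam * (cosh x)\<^sup>2 < kap\<^sup>2" if "0 \<le> x" "x \<le> L" for x using R(2)[of x] that R(1) by simp
  \<comment> \<open>The two bounds obtained so far are at \<open>L\<close>. Since |F| and |P| do not
    decrease on [0, L], they hold at every earlier \<open>r\<close>.\<close>
  note mono = ode_energy_monotone[OF lam kap ok dA dB dD pos B0 r order_refl]
  have q0: "0 < kap\<^sup>2 - lam * (cosh L)\<^sup>2" using L(2) by simp
  have pp: "0 < phase kap lam L" by (rule phase_pos[OF lam kap L])
  have "(norm (F r) * cosh (phase kap lam L))\<^sup>2 = A r * (cosh (phase kap lam L))\<^sup>2"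
    by (simp add: A_def power_mult_distrib power2_norm_eq_inner)
  also have "\<dots> \<le> M\<^sup>2" using 1 mono(2) by (meson mult_right_mono order_trans zero_le_power2)
  finally have "norm (F r) * cosh (phase kap lam L) \<le> M" using M0 by (rule power2_le_imp_le)
  then show "norm (F r) \<le> M / cosh (phase kap lam L)" by (simp add: pos_le_divide_eq)
  have "(norm (P r) * sinh (phase kap lam L))\<^sup>2 = D r * (sinh (phase kap lam L))\<^sup>2"
    by (simp add: D_def power_mult_distrib power2_norm_eq_inner)
  also have "\<dots> \<le> M\<^sup>2 * (kap\<^sup>2 - lam * (cosh L)\<^sup>2)"
    using 2 mono(3) by (meson mult_right_mono order_trans zero_le_power2)
  also have "\<dots> = (M * sqrt (kap\<^sup>2 - lam * (cosh L)\<^sup>2))\<^sup>2" using L(2) by (simp add: power_mult_distrib)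
  finally have "norm (P r) * sinh (phase kap lam L) \<le> M * sqrt (kap\<^sup>2 - lam * (cosh L)\<^sup>2)"
    by (rule power2_le_imp_le) (intro mult_nonneg_nonneg M0 real_sqrt_ge_zero less_imp_le[OF q0])
  then show "norm (P r) \<le> M * sqrt (kap\<^sup>2 - lam * (cosh L)\<^sup>2) / sinh (phase kap lam L)"
    using pp by (simp add: pos_le_divide_eq)
qed

text \<open>Reflection in \<open>r\<close>, with a change of sign in \<open>P\<close>, maps
  solutions to solutions. The even and odd parts therefore solve the system, satisfy the initial
  condition of \<open>ode_bound\<close> and are bounded by \<open>M\<close>; adding the two
  estimates gives the factor 2. Parity reduces negative \<open>r\<close> to positive.\<close>

lemma ode_bound_general:
  fixes F P :: "real \<Rightarrow> 'a::real_inner"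
  assumes lam: "lam > 0" and kap: "kap > 0" and L: "0 \<le> L" "lam * (cosh L)\<^sup>2 < kap\<^sup>2"
    and dF: "\<And>r. (F has_vector_derivative (1 / cosh r) *\<^sub>R P r) (at r)"
    and dP: "\<And>r. (P has_vector_derivative ((kap\<^sup>2 - lam * (cosh r)\<^sup>2) / cosh r) *\<^sub>R F r) (at r)"
    and bd: "\<And>r. norm (F r) \<le> M"
    and r: "\<bar>r\<bar> \<le> L"
  shows "norm (F r) \<le> 2 * M / cosh (phase kap lam L)"
    and "norm (P r) \<le> 2 * M * sqrt (kap\<^sup>2 - lam * (cosh L)\<^sup>2) / sinh (phase kap lam L)"
proof -
  have du: "(uminus has_vector_derivative -1) (at r)" for r :: real
    by (auto intro!: derivative_eq_intros)
  have dFm: "((\<lambda>r. F (- r)) has_vector_derivative - ((1 / cosh r) *\<^sub>R P (- r))) (at r)" for r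
    using vector_diff_chain_at[OF du dF] by (simp add: o_def)
  have dPm: "((\<lambda>r. P (- r)) has_vector_derivative - (((kap\<^sup>2 - lam * (cosh r)\<^sup>2) / cosh r) *\<^sub>R F (- r))) (at r)" for r
    proof -
    have "((\<lambda>r. P (- r)) has_vector_derivative
        (- 1) *\<^sub>R (((kap\<^sup>2 - lam * (cosh (- r))\<^sup>2) / cosh (- r)) *\<^sub>R F (- r))) (at r)"
      using vector_diff_chain_at[OF du[of r] dP[of "- r"]] unfolding o_def .
    then show ?thesis by (simp only: cosh_minus scaleR_minus1_left)
  qed
  define Fe Pe Fo Po where "Fe = (\<lambda>r. (1/2) *\<^sub>R (F r + F (- r)))" and "Pe = (\<lambda>r. (1/2) *\<^sub>R (P r - P (- r)))"
    and "Fo = (\<lambda>r. (1/2) *\<^sub>R (F r - F (- r)))" and "Po = (\<lambda>r. (1/2) *\<^sub>R (P r + P (- r)))"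
  have e: "(Fe has_vector_derivative (1 / cosh r) *\<^sub>R Pe r) (at r)"
    "(Pe has_vector_derivative ((kap\<^sup>2 - lam * (cosh r)\<^sup>2) / cosh r) *\<^sub>R Fe r) (at r)"
    "(Fo has_vector_derivative (1 / cosh r) *\<^sub>R Po r) (at r)"
    "(Po has_vector_derivative ((kap\<^sup>2 - lam * (cosh r)\<^sup>2) / cosh r) *\<^sub>R Fo r) (at r)" for r
    unfolding Fe_def Pe_def Fo_def Po_def
    by (auto intro!: derivative_eq_intros dF dP dFm dPm simp: algebra_simps)
  have be: "norm (Fe r) \<le> M" for r
    using norm_triangle_ineq[of "F r" "F (- r)"] bd[of r] bd[of "- r"] by (simp add: Fe_def)
  have bo: "norm (Fo r) \<le> M" for r
    using norm_triangle_ineq4[of "F r" "F (- r)"] bd[of r] bd[of "- r"] by (simp add: Fo_def)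
  have ie: "Fe 0 = 0 \<or> Pe 0 = 0" "Fo 0 = 0 \<or> Po 0 = 0" by (simp_all add: Pe_def Fo_def)
  have r': "0 \<le> \<bar>r\<bar>" "\<bar>r\<bar> \<le> L" using r by auto
  note E = ode_bound[OF lam kap L e(1,2) ie(1) be r'] and O = ode_bound[OF lam kap L e(3,4) ie(2) bo r']
  have "norm (Fe r) = norm (Fe \<bar>r\<bar>)" "norm (Fo r) = norm (Fo \<bar>r\<bar>)"
    "norm (Pe r) = norm (Pe \<bar>r\<bar>)" "norm (Po r) = norm (Po \<bar>r\<bar>)"
    by (auto simp: Fe_def Fo_def Pe_def Po_def abs_if norm_minus_commute add.commute)
  moreover have "F r = Fe r + Fo r" "P r = Pe r + Po r"
    unfolding Fe_def Fo_def Pe_def Po_def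
    by (simp_all add: scaleR_add_right[symmetric])
  ultimately have "norm (F r) \<le> norm (Fe \<bar>r\<bar>) + norm (Fo \<bar>r\<bar>)" "norm (P r) \<le> norm (Pe \<bar>r\<bar>) + norm (Po \<bar>r\<bar>)"
    using norm_triangle_ineq[of "Fe r" "Fo r"] norm_triangle_ineq[of "Pe r" "Po r"] by simp_all
  then show "norm (F r) \<le> 2 * M / cosh (phase kap lam L)"
    "norm (P r) \<le> 2 * M * sqrt (kap\<^sup>2 - lam * (cosh L)\<^sup>2) / sinh (phase kap lam L)"
    using E O by (simp_all add: add_divide_distrib[symmetric])
qed

section \<open>Convergence of the series in the constants\<close>

lemma phase_lower_bound:
  assumes lam: "lam > 0" and k: "0 < kap0" "kap0 \<le> kap" and L: "0 \<le> L" "lam * (cosh L)\<^sup>2 < kap0\<^sup>2"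
  shows "kap * arccos (kap0 * tanh L / sqrt (kap0\<^sup>2 - lam)) - sqrt lam * pi \<le> phase kap lam L"
    and "0 < arccos (kap0 * tanh L / sqrt (kap0\<^sup>2 - lam))"
proof -
  have kk: "kap0\<^sup>2 \<le> kap\<^sup>2" using k by (intro power_mono) auto
  then have L': "lam * (cosh L)\<^sup>2 < kap\<^sup>2" using L by linarith
  note b0 = phase_args_bound[OF lam k(1) L(2)]
  have kp: "kap > 0" using k by simp
  note b = phase_args_bound[OF lam kp L']
  have p: "0 < kap0\<^sup>2 - lam" "0 < kap\<^sup>2 - lam" using b b0 by auto
  \<comment> \<open>The quotient of \<open>kap\<close> by \<open>sqrt (kap\<^sup>2 - lam)\<close>
    decreases in \<open>kap\<close>, so the angle at \<open>kap0\<close> is a lower bound for all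
    larger \<open>kap\<close>: the phase grows at least linearly in \<open>kap\<close>, at a
    positive rate.\<close>
  have "(kap * sqrt (kap0\<^sup>2 - lam))\<^sup>2 \<le> (kap0 * sqrt (kap\<^sup>2 - lam))\<^sup>2"
    using p kk lam by (simp add: power_mult_distrib algebra_simps)
  then have "kap * sqrt (kap0\<^sup>2 - lam) \<le> kap0 * sqrt (kap\<^sup>2 - lam)"
    by (rule power2_le_imp_le) (use k p in auto)
  then have "kap / sqrt (kap\<^sup>2 - lam) \<le> kap0 / sqrt (kap0\<^sup>2 - lam)" using p by (simp add: divide_simps)
  then have "kap / sqrt (kap\<^sup>2 - lam) * tanh L \<le> kap0 / sqrt (kap0\<^sup>2 - lam) * tanh L"
    using L(1) by (intro mult_right_mono) auto
  then have "kap * tanh L / sqrt (kap\<^sup>2 - lam) \<le> kap0 * tanh L / sqrt (kap0\<^sup>2 - lam)" by simp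
  then have "arccos (kap0 * tanh L / sqrt (kap0\<^sup>2 - lam)) \<le> arccos (kap * tanh L / sqrt (kap\<^sup>2 - lam))"
    using b b0 by (intro arccos_le_arccos) linarith+
  then have "kap * arccos (kap0 * tanh L / sqrt (kap0\<^sup>2 - lam)) \<le> kap * arccos (kap * tanh L / sqrt (kap\<^sup>2 - lam))"
    using kp by (intro mult_left_mono) auto
  moreover have "sqrt lam * arccos (sqrt lam * sinh L / sqrt (kap\<^sup>2 - lam)) \<le> sqrt lam * pi"
    proof (rule mult_left_mono)
      show "arccos (sqrt lam * sinh L / sqrt (kap\<^sup>2 - lam)) \<le> pi" using b(3) by (intro arccos_ubound) linarith+
    qed (use lam in simp)
  ultimately show "kap * arccos (kap0 * tanh L / sqrt (kap0\<^sup>2 - lam)) - sqrt lam * pi \<le> phase kap lam L"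
    unfolding phase_def by linarith
  show "0 < arccos (kap0 * tanh L / sqrt (kap0\<^sup>2 - lam))"
  proof -
    have "arccos 1 < arccos (kap0 * tanh L / sqrt (kap0\<^sup>2 - lam))"
      using b0(2) by (intro arccos_less_arccos) linarith+
    then show ?thesis by simp
  qed
qed

lemma summable_linear_times_exp:
  fixes a c :: real
  assumes "a \<ge> 0" "c > 0"
  shows "summable (\<lambda>j. (1 + a * real j) * exp (- (c * real j)))"
proof (rule summable_comparison_test')
  have "norm (exp (- c)) < 1" using assms by simp
  from geometric_deriv_sums[OF this] have "summable (\<lambda>j. real (Suc j) * exp (- c) ^ j)" by (auto simp: sums_iff)
  then show "summable (\<lambda>j. (1 + a) * (real (Suc j) * exp (- c) ^ j))" by (rule summable_mult)
  fix j :: nat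
  have "exp (- (c * real j)) = exp (- c) ^ j" by (simp add: exp_of_nat_mult[symmetric] mult.commute)
  moreover have "1 + a * real j \<le> (1 + a) * real (Suc j)" using assms by (simp add: algebra_simps)
  ultimately show "norm ((1 + a * real j) * exp (- (c * real j))) \<le> (1 + a) * (real (Suc j) * exp (- c) ^ j)"
    using assms by (simp add: mult.assoc[symmetric] mult_right_mono)
qed

text \<open>At \<open>ln 2 / 2\<close> the value \<open>exp (- x)\<close> is half of
  \<open>exp x\<close>; from there on the difference of the exponentials keeps at least half of
  \<open>exp x\<close>.\<close>

lemma sinh_ge_exp: "ln 2 / 2 \<le> x \<Longrightarrow> exp x / 4 \<le> sinh (x :: real)"
proof -
  assume "ln 2 / 2 \<le> x"
  then have "exp (ln 2) \<le> exp (2 * x)" by (subst exp_le_cancel_iff) simp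
  then have "2 * exp (- x) \<le> exp (2 * x) * exp (- x)" by (intro mult_right_mono) simp_all
  also have "\<dots> = exp x" by (simp add: exp_add[symmetric])
  finally show ?thesis by (simp add: sinh_field_def)
qed

text \<open>One majorant for the series of \<open>A1\<close>, \<open>A2\<close> and
  \<open>A3\<close>. The phase grows linearly with the index, so the terms decay like a linear
  factor times a geometric sequence.\<close>

lemma summable_phase:
  assumes l: "l > 0" and lam: "lam > 0" and L: "0 \<le> L" and K: "K > 0" "lam * (cosh L)\<^sup>2 < (2 * pi * real K / l)\<^sup>2"
  shows "summable (\<lambda>j. (1 + 2 * pi * real (K + j) / l) / sinh (phase (2 * pi * real (K + j) / l) lam L))"
proof -
  define kap where "kap = (\<lambda>j. 2 * pi * real (K + j) / l)"
  define th where "th = arccos (kap 0 * tanh L / sqrt ((kap 0)\<^sup>2 - lam))"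
  have k0: "0 < kap 0" "kap 0 \<le> kap j" for j using l K by (auto simp: kap_def divide_simps)
  have K': "lam * (cosh L)\<^sup>2 < (kap 0)\<^sup>2" using K by (simp add: kap_def)
  have low: "kap j * th - sqrt lam * pi \<le> phase (kap j) lam L" and th: "0 < th" for j
    unfolding th_def by (rule phase_lower_bound[OF lam k0 L K'])+
  define c where "c = 2 * pi / l * th"
  have c: "c > 0" using l th by (simp add: c_def)
  have kj: "kap j = kap 0 + 2 * pi / l * real j" for j by (simp add: kap_def field_simps add_divide_distrib)
  have low': "c * real j - sqrt lam * pi \<le> phase (kap j) lam L" for j
  proof -
    have "kap j * th = kap 0 * th + c * real j" unfolding kj[of j] c_def by (simp add: algebra_simps)
    moreover have "0 \<le> kap 0 * th" using k0(1) th by simp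
    ultimately show ?thesis using low[of j] by linarith
  qed
  \<comment> \<open>The 4 comes from \<open>sinh_ge_exp\<close>, \<open>exp (sqrt lam * pi)\<close>
    makes up for the constant lost in \<open>low'\<close>, and the remaining linear factors bound
    \<open>1 + kap j\<close>.\<close>
  define g where "g = (\<lambda>j. (1 + kap 0) * 4 * exp (sqrt lam * pi) * ((1 + 2 * pi / l * real j) * exp (- (c * real j))))"
  have "\<forall>\<^sub>F j in sequentially. norm ((1 + kap j) / sinh (phase (kap j) lam L)) \<le> g j"
  proof -
    \<comment> \<open>From \<open>j0\<close> on, the lower bound for the phase reaches the threshold
      of \<open>sinh_ge_exp\<close>.\<close>
    obtain j0 where j0: "real j0 > (ln 2 / 2 + sqrt lam * pi) / c" using reals_Archimedean2 by blast
    have "norm ((1 + kap j) / sinh (phase (kap j) lam L)) \<le> g j" if "j \<ge> j0" for j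
    proof -
      define x where "x = c * real j - sqrt lam * pi"
      have "(ln 2 / 2 + sqrt lam * pi) / c \<le> real j" using that j0 by linarith
      then have x: "ln 2 / 2 \<le> x" using c by (simp add: x_def pos_divide_le_eq mult.commute)
      then have "exp x / 4 \<le> sinh x" by (rule sinh_ge_exp)
      also have "\<dots> \<le> sinh (phase (kap j) lam L)" using low'[of j] by (simp add: x_def)
      finally have s: "exp x / 4 \<le> sinh (phase (kap j) lam L)" .
      have kp: "0 \<le> 1 + kap j" using k0(1) k0(2)[of j] by linarith
      have e: "0 < exp x / 4" by simp
      with s have sp: "0 < sinh (phase (kap j) lam L)" by linarith
      have "norm ((1 + kap j) / sinh (phase (kap j) lam L)) = (1 + kap j) / sinh (phase (kap j) lam L)"
        using kp sp by simp
      also have "\<dots> \<le> (1 + kap j) / (exp x / 4)" by (rule divide_left_mono[OF s kp mult_pos_pos[OF sp e]])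
      also have "\<dots> = (1 + kap j) * (4 * exp (sqrt lam * pi) * exp (- (c * real j)))"
        by (simp add: x_def exp_diff exp_minus field_simps)
      also have "\<dots> \<le> ((1 + kap 0) * (1 + 2 * pi / l * real j)) * (4 * exp (sqrt lam * pi) * exp (- (c * real j)))"
        proof (rule mult_right_mono)
        define y where "y = 2 * pi / l * real j"
        have "0 \<le> kap 0 * y" using k0(1) l by (simp add: y_def)
        then show "1 + kap j \<le> (1 + kap 0) * (1 + 2 * pi / l * real j)"
          unfolding kj[of j] y_def[symmetric] by (simp add: algebra_simps)
      qed simp
      also have "\<dots> = g j" unfolding g_def by (simp only: mult_ac)
      finally show ?thesis .
    qed
    then show ?thesis unfolding eventually_sequentially by blast
  qed
  moreover have "summable g" unfolding g_def
    using l c by (intro summable_mult summable_linear_times_exp) auto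
  ultimately show ?thesis unfolding kap_def by (rule summable_comparison_test_ev)
qed

text \<open>Comparison with the majorant of \<open>summable_phase\<close>: the numerators 1,
  \<open>kap\<close> and the square root are at most \<open>1 + kap\<close>, and \<open>sinh\<close>
  lies below \<open>cosh\<close>.\<close>

lemma phase_series_bounds:
  assumes lam: "lam > 0" and kap: "kap > 0" and L: "0 \<le> L" "lam * (cosh L)\<^sup>2 < kap\<^sup>2"
  shows "0 \<le> 1 / cosh (phase kap lam L)" "1 / cosh (phase kap lam L) \<le> (1 + kap) / sinh (phase kap lam L)"
    "0 \<le> kap * (1 / cosh (phase kap lam L))" "kap * (1 / cosh (phase kap lam L)) \<le> (1 + kap) / sinh (phase kap lam L)"
    "0 \<le> sqrt (kap\<^sup>2 - lam * (cosh L)\<^sup>2) * (1 / sinh (phase kap lam L))"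
    "sqrt (kap\<^sup>2 - lam * (cosh L)\<^sup>2) * (1 / sinh (phase kap lam L)) \<le> (1 + kap) / sinh (phase kap lam L)"
proof -
  have s: "0 < sinh (phase kap lam L)" using phase_pos[OF assms] by simp
  have sc: "sinh (phase kap lam L) \<le> cosh (phase kap lam L)" using sinh_less_cosh_real less_imp_le by blast
  have c: "0 < cosh (phase kap lam L)" by simp
  have "sqrt (kap\<^sup>2 - lam * (cosh L)\<^sup>2) \<le> sqrt (kap\<^sup>2)" using lam by (intro real_sqrt_le_mono) simp
  then have q: "sqrt (kap\<^sup>2 - lam * (cosh L)\<^sup>2) \<le> 1 + kap" using kap by simp
  show "0 \<le> 1 / cosh (phase kap lam L)" "0 \<le> kap * (1 / cosh (phase kap lam L))"
    "0 \<le> sqrt (kap\<^sup>2 - lam * (cosh L)\<^sup>2) * (1 / sinh (phase kap lam L))" using kap s L by simp_all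
  show "1 / cosh (phase kap lam L) \<le> (1 + kap) / sinh (phase kap lam L)"
    using kap s sc by (intro frac_le) auto
  have "kap / cosh (phase kap lam L) \<le> (1 + kap) / sinh (phase kap lam L)"
    using kap s sc by (intro frac_le) auto
  then show "kap * (1 / cosh (phase kap lam L)) \<le> (1 + kap) / sinh (phase kap lam L)" by simp
  have "sqrt (kap\<^sup>2 - lam * (cosh L)\<^sup>2) / sinh (phase kap lam L) \<le> (1 + kap) / sinh (phase kap lam L)"
    using q s by (intro divide_right_mono) auto
  then show "sqrt (kap\<^sup>2 - lam * (cosh L)\<^sup>2) * (1 / sinh (phase kap lam L)) \<le> (1 + kap) / sinh (phase kap lam L)" by simp
qed

section \<open>Fourier series of periodic functions\<close>

definition emode :: "real \<Rightarrow> int \<Rightarrow> real \<Rightarrow> complex" where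
  "emode l k t = cis (2 * pi * real_of_int k * t / l)"

definition fcoef :: "real \<Rightarrow> int \<Rightarrow> (real \<Rightarrow> complex) \<Rightarrow> complex" where
  "fcoef l k w = integral {0..l} (\<lambda>t. w t * emode l (- k) t) / of_real l"

lemma emode_eq_exp:
  "emode l k t = exp (2 * of_real pi * \<i> * of_int k * of_real t / of_real l)"
  by (simp add: emode_def cis_conv_exp mult_ac)

lemma norm_emode [simp]: "norm (emode l k t) = 1"
  by (simp add: emode_def)

lemma emode_0 [simp]: "emode l 0 t = 1"
  by (simp add: emode_def)

lemma emode_at_0 [simp]: "emode l k 0 = 1"
  by (simp add: emode_def)

lemma emode_mult: "emode l j t * emode l k t = emode l (j + k) t"
  by (simp add: emode_def cis_mult ring_distribs add_divide_distrib)

lemma emode_periodic: "l > 0 \<Longrightarrow> emode l k (t + l) = emode l k t"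
proof -
  assume l: "l > 0"
  have "2 * pi * real_of_int k * (t + l) / l = 2 * pi * real_of_int k * t / l + 2 * pi * real_of_int k"
    using l by (simp add: field_simps)
  then show ?thesis by (simp add: emode_def cis_mult[symmetric] cis_multiple_2pi)
qed

lemma continuous_on_emode [continuous_intros]:
  "continuous_on S g \<Longrightarrow> continuous_on S (\<lambda>x. emode l k (g x))"
  unfolding emode_def divide_inverse by (intro continuous_intros)

lemma has_vector_derivative_emode:
  "(emode l k has_vector_derivative of_real (2 * pi * real_of_int k / l) * \<i> * emode l k t) (at t within S)"
proof -
  define c where "c = complex_of_real (2 * pi * real_of_int k / l) * \<i>"
  have e: "emode l k = exp \<circ> (\<lambda>t. c * of_real t)"
    by (simp add: fun_eq_iff emode_eq_exp c_def field_simps)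
  have "((\<lambda>t. c * of_real t) has_vector_derivative c) (at t within S)"
    by (auto intro!: derivative_eq_intros)
  from field_vector_diff_chain_within[OF this has_field_derivative_at_within[OF DERIV_exp]]
  show ?thesis unfolding e c_def[symmetric] by (simp add: o_def)
qed

lemma integral_emode:
  assumes "l > 0"
  shows "integral {0..l} (emode l k) = (if k = 0 then of_real l else 0)"
proof (cases "k = 0")
  case True
  then have "emode l k = (\<lambda>t. 1)" by auto
  then show ?thesis using assms True by (simp add: of_real_def)
next
  case False
  define c where "c = of_real (2 * pi * real_of_int k / l) * \<i>"
  have c: "c \<noteq> 0" using False assms by (simp add: c_def)
  have "((\<lambda>t. c * emode l k t) has_integral (emode l k l - emode l k 0)) {0..l}"
    unfolding c_def using assms by (intro fundamental_theorem_of_calculus has_vector_derivative_emode) auto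
  moreover have "emode l k l = emode l k 0" using emode_periodic[OF assms, of k 0] by simp
  ultimately have "((\<lambda>t. c * emode l k t) has_integral 0) {0..l}" by simp
  then have "((\<lambda>t. emode l k t) has_integral 0 / c) {0..l}"
    using has_integral_mult_right[of "\<lambda>t. c * emode l k t" 0 "{0..l}" "1 / c"] c by simp
  then show ?thesis using False by (simp add: integral_unique)
qed

lemma fcoef_integrable:
  "continuous_on UNIV w \<Longrightarrow> (\<lambda>t. w t * emode l k t) integrable_on {0..l}"
  by (intro integrable_continuous_interval continuous_intros) (auto intro: continuous_on_subset)

lemma fcoef_add:
  assumes "continuous_on UNIV v" "continuous_on UNIV w"
  shows "fcoef l k (\<lambda>t. v t + w t) = fcoef l k v + fcoef l k w"
  unfolding fcoef_def
  by (simp add: distrib_right integral_add[OF assms[THEN fcoef_integrable]] add_divide_distrib)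

lemma fcoef_cmult: "fcoef l k (\<lambda>t. c * w t) = c * fcoef l k w"
  unfolding fcoef_def by (simp add: mult.assoc integral_mult_right)

lemma fcoef_minus: "fcoef l k (\<lambda>t. - w t) = - fcoef l k w"
  using fcoef_cmult[of l k "-1" w] by simp

lemma fcoef_diff:
  assumes "continuous_on UNIV v" "continuous_on UNIV w"
  shows "fcoef l k (\<lambda>t. v t - w t) = fcoef l k v - fcoef l k w"
  using fcoef_add[OF assms(1) continuous_on_minus[OF assms(2)]] by (simp add: fcoef_minus)

lemma fcoef_emode:
  assumes "l > 0"
  shows "fcoef l j (\<lambda>t. c * emode l k t) = (if j = k then c else 0)"
  using assms by (auto simp: fcoef_def mult.assoc emode_mult integral_mult_right
      integral_emode[OF assms, unfolded emode_def[abs_def]] integral_emode)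

lemma fcoef_sum:
  assumes "finite A" "\<And>i. i \<in> A \<Longrightarrow> continuous_on UNIV (w i)"
  shows "fcoef l k (\<lambda>t. \<Sum>i\<in>A. w i t) = (\<Sum>i\<in>A. fcoef l k (w i))"
  using assms
proof (induction A rule: finite_induct)
  case empty
  then show ?case by (simp add: fcoef_def)
next
  case (insert a A)
  then show ?case by (simp add: fcoef_add continuous_on_sum)
qed

lemma fcoef_partial_sum:
  assumes "l > 0" "finite A"
  shows "fcoef l j (\<lambda>t. \<Sum>k\<in>A. c k * emode l k t) = (if j \<in> A then c j else 0)"
proof -
  have "fcoef l j (\<lambda>t. \<Sum>k\<in>A. c k * emode l k t) = (\<Sum>k\<in>A. fcoef l j (\<lambda>t. c k * emode l k t))"
    using assms(2) by (intro fcoef_sum continuous_intros)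
  also have "\<dots> = (\<Sum>k\<in>A. if j = k then c k else 0)" by (simp only: fcoef_emode[OF assms(1)])
  finally show ?thesis using assms(2) by simp
qed

lemma norm_fcoef_le:
  assumes "l > 0" "continuous_on UNIV w" "\<And>t. norm (w t) \<le> M"
  shows "norm (fcoef l k w) \<le> M"
proof -
  have "norm (integral {0..l} (\<lambda>t. w t * emode l (- k) t)) \<le> M * (l - 0)"
    using assms by (intro integral_bound continuous_intros)
      (auto intro: continuous_on_subset simp: norm_mult)
  then show ?thesis using assms(1) by (simp add: fcoef_def norm_divide pos_divide_le_eq)
qed

text \<open>Integration by parts; the boundary terms cancel because \<open>w\<close> and the
  exponential take equal values at 0 and \<open>l\<close>.\<close>

lemma fcoef_derivative:
  assumes l: "l > 0" and d: "\<And>t. (w has_vector_derivative w' t) (at t)"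
    and c: "continuous_on UNIV w'" and p: "w l = w 0"
  shows "fcoef l k w' = of_real (2 * pi * real_of_int k / l) * \<i> * fcoef l k w"
proof -
  define a where "a = of_real (2 * pi * real_of_int k / l) * \<i>"
  have cw: "continuous_on UNIV w"
    using d by (intro continuous_at_imp_continuous_on ballI has_vector_derivative_continuous) auto
  have "((\<lambda>t. w t * emode l (- k) t) has_vector_derivative
      w t * (- a * emode l (- k) t) + w' t * emode l (- k) t) (at t within {0..l})" for t
    using has_vector_derivative_mult[OF has_vector_derivative_at_within[OF d] has_vector_derivative_emode[of l "- k" t "{0..l}"]]
    by (simp add: a_def)
  then have "((\<lambda>t. w t * (- a * emode l (- k) t) + w' t * emode l (- k) t) has_integral
      w l * emode l (- k) l - w 0 * emode l (- k) 0) {0..l}"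
    using l by (intro fundamental_theorem_of_calculus) auto
  moreover have "emode l (- k) l = emode l (- k) 0" using emode_periodic[OF l, of "- k" 0] by simp
  ultimately have "((\<lambda>t. w' t * emode l (- k) t - a * (w t * emode l (- k) t)) has_integral 0) {0..l}"
    using p by (simp add: algebra_simps)
  then have "integral {0..l} (\<lambda>t. w' t * emode l (- k) t - a * (w t * emode l (- k) t)) = 0"
    by (rule integral_unique)
  also have "integral {0..l} (\<lambda>t. w' t * emode l (- k) t - a * (w t * emode l (- k) t))
      = integral {0..l} (\<lambda>t. w' t * emode l (- k) t) - a * integral {0..l} (\<lambda>t. w t * emode l (- k) t)"
    by (simp add: integral_diff fcoef_integrable[OF c] integrable_on_mult_right fcoef_integrable[OF cw])
  finally show ?thesis by (simp add: fcoef_def a_def)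
qed

section \<open>Completeness of the exponentials on the circle\<close>

lemma periodic_add_int:
  assumes p: "\<And>t. w (t + l) = w t"
  shows "w (t + real_of_int n * l) = (w t :: 'a)"
proof -
  have nat: "w (t + real m * l) = w t" for m t
  proof (induction m)
    case (Suc m)
    have "w (t + real (Suc m) * l) = w ((t + real m * l) + l)" by (simp add: algebra_simps)
    then show ?case using Suc p by simp
  qed simp
  show ?thesis
  proof (cases "n \<ge> 0")
    case True
    then show ?thesis using nat[of t "nat n"] by simp
  next
    case False
    then show ?thesis using nat[of "t + real_of_int n * l" "nat (- n)"] by (simp add: algebra_simps)
  qed
qed

text \<open>Moves the function to the compact unit circle, where Stone-Weierstrass applies.
  \<open>Arg\<close> inverts the parametrization, and the choice of its branch is immaterial since
  \<open>v\<close> takes equal values wherever \<open>cis\<close> does.\<close>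

lemma periodic_factors_through_circle:
  fixes w :: "real \<Rightarrow> 'a::topological_space"
  assumes l: "l > 0" and c: "continuous_on UNIV w" and p: "\<And>t. w (t + l) = w t"
  obtains W where "continuous_on (sphere 0 1 :: complex set) W" "\<And>t. w t = W (cis (2 * pi * t / l))"
proof -
  define v where "v = (\<lambda>x. w (l * x / (2 * pi)))"
  have cv: "continuous_on UNIV v" unfolding v_def
    by (rule continuous_on_compose2[OF c]) (auto intro!: continuous_intros)
  have vp: "v x = v y" if "cis x = cis y" for x y
  proof -
    have "sin x = sin y \<and> cos x = cos y" using that by (auto simp: complex_eq_iff)
    then obtain n :: int where "x = y + 2 * pi * n" using sin_cos_eq_iff[of x y] by blast
    then have "l * x / (2 * pi) = l * y / (2 * pi) + real_of_int n * l" using l by (simp add: field_simps)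
    then show ?thesis unfolding v_def using periodic_add_int[of w l, OF p] by metis
  qed
  have cA: "cis (Arg z) = z" if "z \<in> sphere 0 1" for z
  proof -
    have "norm z = 1" using that by simp
    moreover from this have "z \<noteq> 0" by auto
    ultimately show ?thesis using cis_Arg[of z] by (simp add: sgn_div_norm)
  qed
  define W where "W = (\<lambda>z. v (Arg z))"
  have W: "W z = v x" if "z = cis x" for z x unfolding W_def using that by (intro vp) (simp add: cA)
  have v_at: "isCont v x" for x using cv by (simp add: continuous_on_eq_continuous_at)
  show ?thesis
  proof
    show "w t = W (cis (2 * pi * t / l))" for t using l by (subst W[OF refl]) (simp add: v_def)
    show "continuous_on (sphere 0 1) W"
    proof (rule continuous_on_eq_continuous_within[THEN iffD2], rule ballI)
      fix z :: complex assume z: "z \<in> sphere 0 1"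
      show "continuous (at z within sphere 0 1) W"
      proof (cases "z \<in> \<real>\<^sub>\<le>\<^sub>0")
        case False
        have "isCont W z" unfolding W_def by (rule isCont_o2[OF continuous_at_Arg[OF False] v_at])
        then show ?thesis by (rule continuous_at_imp_continuous_within)
      next
        case True
        \<comment> \<open>\<open>Arg\<close> jumps across the negative real axis. Near such a point
          \<open>Arg (- z) + pi\<close> is a continuous choice of the argument, and by periodicity
          it yields the same function.\<close>
        then have "- z \<notin> \<real>\<^sub>\<le>\<^sub>0" using z by (auto simp: complex_nonpos_Reals_iff complex_eq_iff cmod_def)
        then have "isCont Arg (- z)" by (rule continuous_at_Arg)
        then have "isCont (\<lambda>z. Arg (- z)) z" by (rule isCont_o2[OF isCont_minus[OF continuous_ident]])
        then have "isCont (\<lambda>z. Arg (- z) + pi) z" by (intro continuous_intros)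
        then have "isCont (\<lambda>z. v (Arg (- z) + pi)) z" by (rule isCont_o2) (rule v_at)
        then have "continuous (at z within sphere 0 1) (\<lambda>z. v (Arg (- z) + pi))"
          by (rule continuous_at_imp_continuous_within)
        moreover have "v (Arg (- y) + pi) = W y" if "y \<in> sphere 0 1" for y
          using cA[of "- y"] that by (subst W[of y "Arg (- y) + pi"]) (simp_all add: cis_mult[symmetric])
        ultimately show ?thesis
          by (rule continuous_transform_within[OF _ zero_less_one z])
      qed
    qed
  qed
qed

text \<open>Quantifying over every \<open>w\<close> makes this class closed under products, so that
  it can be shown by induction to contain all trigonometric polynomials, with no expansion of their
  products into exponentials.\<close>

definition zero_coef_multiplier :: "real \<Rightarrow> (real \<Rightarrow> complex) \<Rightarrow> bool" where
  "zero_coef_multiplier l g \<longleftrightarrow> continuous_on UNIV g \<and>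
     (\<forall>w. continuous_on UNIV w \<longrightarrow> (\<forall>k. fcoef l k w = 0) \<longrightarrow> (\<forall>k. fcoef l k (\<lambda>t. w t * g t) = 0))"

lemma zero_coef_multiplier_add:
  assumes "zero_coef_multiplier l g" "zero_coef_multiplier l h"
  shows "zero_coef_multiplier l (\<lambda>t. g t + h t)"
  using assms unfolding zero_coef_multiplier_def
  by (auto simp: distrib_left fcoef_add continuous_on_mult intro!: continuous_intros)

lemma zero_coef_multiplier_mult:
  assumes "zero_coef_multiplier l g" "zero_coef_multiplier l h"
  shows "zero_coef_multiplier l (\<lambda>t. g t * h t)"
  using assms unfolding zero_coef_multiplier_def
  by (auto simp: mult.assoc[symmetric] intro!: continuous_intros)

lemma zero_coef_multiplier_emode: "zero_coef_multiplier l (\<lambda>t. c * emode l j t)"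
  unfolding zero_coef_multiplier_def
proof (intro conjI allI impI)
  show "continuous_on UNIV (\<lambda>t. c * emode l j t)" by (intro continuous_intros)
next
  fix w k assume "\<forall>k. fcoef l k w = 0"
  then have "c * fcoef l (k - j) w = 0" by simp
  then show "fcoef l k (\<lambda>t. w t * (c * emode l j t)) = 0"
    unfolding fcoef_cmult[symmetric] by (simp add: fcoef_def mult_ac emode_mult)
qed

lemma zero_coef_multiplier_polynomial:
  assumes "real_polynomial_function p"
  shows "zero_coef_multiplier l (\<lambda>t. of_real (p (cis (2 * pi * t / l))))"
  using assms
proof (induction p rule: real_polynomial_function.induct)
  case (linear f)
  interpret bounded_linear f by fact
  \<comment> \<open>Euler's formulas for cosine and sine, inserted into
    \<open>f (cis x) = cos x * f 1 + sin x * f \<i>\<close>.\<close>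
  have "complex_of_real (f (cis (2 * pi * t / l)))
      = (of_real (f 1) + of_real (f \<i>) / \<i>) / 2 * emode l 1 t
      + (of_real (f 1) - of_real (f \<i>) / \<i>) / 2 * emode l (- 1) t" for t
  proof -
    define x where "x = 2 * pi * t / l"
    have "cis x = cos x *\<^sub>R 1 + sin x *\<^sub>R \<i>" by (simp add: complex_eq_iff)
    then have "f (cis x) = cos x * f 1 + sin x * f \<i>" by (simp add: add scaleR)
    moreover have "emode l 1 t = cis x" "emode l (- 1) t = cis (- x)" by (simp_all add: emode_def x_def)
    ultimately show ?thesis unfolding x_def[symmetric] by (simp add: complex_eq_iff field_simps)
  qed
  then show ?case by (simp only: zero_coef_multiplier_add zero_coef_multiplier_emode)
next
  case (const c)
  show ?case using zero_coef_multiplier_emode[of l "of_real c" 0] by simp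
next
  case (add f g)
  then show ?case by (simp add: zero_coef_multiplier_add)
next
  case (mult f g)
  then show ?case by (simp add: zero_coef_multiplier_mult)
qed

text \<open>By Stone-Weierstrass, \<open>cnj w\<close> is a uniform limit of trigonometric polynomials, to which \<open>w\<close> is
  orthogonal; hence \<open>w\<close> is orthogonal to itself.\<close>

lemma fcoef_zero_imp_zero:
  assumes l: "l > 0" and c: "continuous_on UNIV w" and p: "\<And>t. w (t + l) = w t"
    and z: "\<And>k. fcoef l k w = 0"
  shows "w t = 0"
proof -
  obtain W where W: "continuous_on (sphere 0 1 :: complex set) W" "\<And>t. cnj (w t) = W (cis (2 * pi * t / l))"
    using periodic_factors_through_circle[of l "\<lambda>t. cnj (w t)"] l p continuous_on_cnj[OF c] by metis
  have cw: "continuous_on S w" for S using c by (rule continuous_on_subset) simp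
  have cn: "continuous_on S (\<lambda>t. (cmod (w t))\<^sup>2)" for S by (intro continuous_intros cw)
  define J where "J = integral {0..l} (\<lambda>t. (cmod (w t))\<^sup>2)"
  have "bounded (w ` {0..l})" by (intro compact_imp_bounded compact_continuous_image cw) simp
  then obtain M where M: "\<forall>t\<in>{0..l}. norm (w t) \<le> M" "M > 0"
    unfolding bounded_pos by auto
  have small: "J \<le> e" if e: "e > 0" for e
  proof -
    \<comment> \<open>The tolerance is divided by the bound of \<open>w\<close> and by the length of
      the period, so that the final integral is at most \<open>e\<close>.\<close>
    have "e / (M * l) > 0" using e M l by simp
    from Stone_Weierstrass_polynomial_function[OF compact_sphere W(1) this]
    obtain g where g: "polynomial_function g" "\<forall>x\<in>sphere 0 1. norm (W x - g x) < e / (M * l)" by blast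
    have gm: "zero_coef_multiplier l (\<lambda>t. g (cis (2 * pi * t / l)))"
    proof -
      have "real_polynomial_function (\<lambda>z. Re (g z))" "real_polynomial_function (\<lambda>z. Im (g z))"
        using g(1) bounded_linear_Re bounded_linear_Im by (auto simp: polynomial_function_def o_def)
      note this[THEN zero_coef_multiplier_polynomial, of l]
      \<comment> \<open>\<open>emode l 0\<close> is 1; it brings the constant \<open>\<i>\<close>
        into the form of a multiplier.\<close>
      then have "zero_coef_multiplier l (\<lambda>t. of_real (Re (g (cis (2 * pi * t / l))))
          + \<i> * emode l 0 t * of_real (Im (g (cis (2 * pi * t / l)))))"
        by (intro zero_coef_multiplier_add zero_coef_multiplier_mult zero_coef_multiplier_emode)
      then show ?thesis by (simp add: complex_eq[symmetric])
    qed
    define h where "h = (\<lambda>t. g (cis (2 * pi * t / l)))"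
    have ch: "continuous_on S h" for S
      using gm unfolding zero_coef_multiplier_def h_def by (auto intro: continuous_on_subset)
    have "fcoef l 0 (\<lambda>t. w t * h t) = 0"
      using gm c z unfolding zero_coef_multiplier_def h_def by blast
    then have i0: "integral {0..l} (\<lambda>t. w t * h t) = 0" using l by (simp add: fcoef_def)
    have "of_real J = integral {0..l} (\<lambda>t. complex_of_real ((cmod (w t))\<^sup>2))"
      unfolding J_def
      using integral_linear[OF integrable_continuous_interval[OF cn] bounded_linear_of_real[where 'a = complex], of 0 l]
      by (simp add: o_def)
    also have "\<dots> = integral {0..l} (\<lambda>t. w t * cnj (w t))" by (simp only: complex_norm_square)
    also have "\<dots> = integral {0..l} (\<lambda>t. w t * cnj (w t)) - integral {0..l} (\<lambda>t. w t * h t)" using i0 by simp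
    also have "\<dots> = integral {0..l} (\<lambda>t. w t * cnj (w t) - w t * h t)"
      by (intro integral_diff[symmetric] integrable_continuous_interval continuous_intros cw ch)
    finally have "complex_of_real J = integral {0..l} (\<lambda>t. w t * cnj (w t) - w t * h t)" .
    then have "\<bar>J\<bar> = norm (integral {0..l} (\<lambda>t. w t * cnj (w t) - w t * h t))"
      by (metis norm_of_real)
    also have "\<dots> \<le> e / l * (l - 0)"
    proof (rule integral_bound)
      show "continuous_on {0..l} (\<lambda>t. w t * cnj (w t) - w t * h t)" by (intro continuous_intros cw ch)
      fix t assume t: "t \<in> {0..l}"
      have "norm (w t * cnj (w t) - w t * h t) = norm (w t) * norm (W (cis (2 * pi * t / l)) - h t)"
        by (simp add: right_diff_distrib[symmetric] norm_mult W(2))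
      also have "\<dots> \<le> M * (e / (M * l))"
      proof (rule mult_mono)
        show "norm (W (cis (2 * pi * t / l)) - h t) \<le> e / (M * l)"
          using g(2) unfolding h_def by (simp add: less_imp_le)
      qed (use M t in auto)
      finally show "norm (w t * cnj (w t) - w t * h t) \<le> e / l" using M(2) by simp
    qed (use l in simp)
    finally show "J \<le> e" using l by simp
  qed
  have "J \<ge> 0" unfolding J_def by (intro integral_nonneg integrable_continuous_interval cn) simp
  then have "J = 0" using small by (metis dense_ge order_antisym)
  moreover have "((\<lambda>t. (cmod (w t))\<^sup>2) has_integral J) {0..l}"
    unfolding J_def by (intro integrable_integral integrable_continuous_interval cn)
  ultimately have z0: "w x = 0" if "x \<in> {0..l}" for x
    using has_integral_0_cbox_imp_0[of 0 l "\<lambda>t. (cmod (w t))\<^sup>2" x] that cn l by auto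
  define n where "n = \<lfloor>t / l\<rfloor>"
  have "real_of_int n * l \<le> t" "t \<le> (real_of_int n + 1) * l"
    using l by (simp_all add: n_def pos_le_divide_eq[symmetric] pos_divide_le_eq[symmetric])
  then have "w (t - real_of_int n * l) = 0" by (intro z0) (auto simp: algebra_simps)
  then show ?thesis using periodic_add_int[of w l "t - real_of_int n * l" n, OF p] by simp
qed

section \<open>Absolutely convergent Fourier series and their tails\<close>

lemma fcoef_has_sum:
  assumes l: "l > 0" and s: "\<And>t. ((\<lambda>k. c k * emode l k t) has_sum w t) UNIV"
  shows "continuous_on UNIV w" "fcoef l j w = c j"
proof -
  \<comment> \<open>At t = 0 all exponentials are 1, and summability of complex families is
    absolute; so this single point yields a majorant uniform in \<open>t\<close>.\<close>
  have "(\<lambda>k. c k * emode l k 0) summable_on UNIV" using s by (rule has_sum_imp_summable)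
  then have ns: "(\<lambda>k. norm (c k)) summable_on UNIV"
    by (simp add: summable_on_iff_abs_summable_on_complex)
  have "uniform_limit UNIV (\<lambda>A t. \<Sum>k\<in>A. c k * emode l k t) (\<lambda>t. \<Sum>\<^sub>\<infinity>k\<in>UNIV. c k * emode l k t)
      (finite_subsets_at_top UNIV)"
    by (rule Weierstrass_m_test_general[OF _ ns]) (simp add: norm_mult)
  moreover have "(\<lambda>t. \<Sum>\<^sub>\<infinity>k\<in>UNIV. c k * emode l k t) = w" by (intro ext infsumI s)
  ultimately have ul: "uniform_limit UNIV (\<lambda>A t. \<Sum>k\<in>A. c k * emode l k t) w (finite_subsets_at_top UNIV)"
    by simp
  show cw: "continuous_on UNIV w"
    by (rule uniform_limit_theorem[OF _ ul]) (auto intro!: always_eventually continuous_intros)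
  have "uniform_limit UNIV (\<lambda>A t. (\<Sum>k\<in>A. c k * emode l k t) - w t) (\<lambda>t. w t - w t) (finite_subsets_at_top UNIV)"
    by (intro uniform_limit_intros ul)
  then have ul0: "uniform_limit UNIV (\<lambda>A t. (\<Sum>k\<in>A. c k * emode l k t) - w t) (\<lambda>t. 0) (finite_subsets_at_top UNIV)"
    by simp
  have "norm (c j - fcoef l j w) \<le> e" if e: "e > 0" for e
  proof -
    from uniform_limitD[OF ul0 e]
    have "\<forall>\<^sub>F A in finite_subsets_at_top UNIV. \<forall>t. norm ((\<Sum>k\<in>A. c k * emode l k t) - w t) < e"
      by (simp add: dist_norm)
    then obtain A where A: "finite A" "\<And>B t. finite B \<Longrightarrow> A \<subseteq> B \<Longrightarrow> norm ((\<Sum>k\<in>B. c k * emode l k t) - w t) < e"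
      unfolding eventually_finite_subsets_at_top by auto
    \<comment> \<open>Once \<open>j\<close> is in the index set, the partial sum has
      \<open>j\<close>-th coefficient exactly \<open>c j\<close>, and uniform closeness to
      \<open>w\<close> bounds the difference.\<close>
    define B where "B = insert j A"
    have B: "finite B" "A \<subseteq> B" "j \<in> B" using A(1) by (auto simp: B_def)
    have cB: "continuous_on UNIV (\<lambda>t. \<Sum>k\<in>B. c k * emode l k t)" by (intro continuous_intros)
    have "c j - fcoef l j w = fcoef l j (\<lambda>t. (\<Sum>k\<in>B. c k * emode l k t) - w t)"
      using B by (simp add: fcoef_diff[OF cB cw] fcoef_partial_sum[OF l])
    also have "norm \<dots> \<le> e"
      using A(2)[OF B(1,2)] by (intro norm_fcoef_le l continuous_on_diff cB cw less_imp_le)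
    finally show ?thesis .
  qed
  then have "norm (c j - fcoef l j w) \<le> 0" by (meson dense_ge)
  then show "fcoef l j w = c j" by simp
qed

text \<open>The complement of the window consists of the integers \<open>int (N + 1 + j)\<close> and
  their negatives. Each half carries a copy of \<open>G\<close>, whence the factor 2; the truncated
  subtraction recovers \<open>j\<close>.\<close>

lemma int_tail_has_sum:
  fixes G :: "nat \<Rightarrow> real"
  assumes "summable G" "\<And>j. 0 \<le> G j"
  shows "((\<lambda>k. if k \<in> {- int N..int N} then 0 else G (nat \<bar>k\<bar> - Suc N)) has_sum 2 * suminf G) UNIV"
proof -
  define h where "h = (\<lambda>k. if k \<in> {- int N..int N} then 0 else G (nat \<bar>k\<bar> - Suc N))"
  have G: "(G has_sum suminf G) UNIV"
    using assms by (intro norm_summable_imp_has_sum summable_sums) (simp_all add: summable_norm_cancel)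
  define p m where "p = (\<lambda>j::nat. int (N + 1 + j))" and "m = (\<lambda>j::nat. - int (N + 1 + j))"
  have inj: "inj p" "inj m" by (auto simp: p_def m_def inj_def)
  have "nat \<bar>p j\<bar> - Suc N = j" "nat \<bar>m j\<bar> - Suc N = j" for j unfolding p_def m_def by arith+
  moreover have "p j \<notin> {- int N..int N}" "m j \<notin> {- int N..int N}" for j by (simp_all add: p_def m_def)
  ultimately have hp: "h \<circ> p = G" "h \<circ> m = G" by (simp_all only: h_def o_def if_False)
  have 1: "(h has_sum suminf G) (range p)" "(h has_sum suminf G) (range m)"
    using G by (simp_all add: has_sum_reindex inj hp)
  have "range p \<inter> range m = {}" by (auto simp: p_def m_def)
  from has_sum_Un_disjoint[OF 1 this]
  have "(h has_sum 2 * suminf G) (range p \<union> range m)" by simp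
  then have "(h has_sum 2 * suminf G) UNIV"
  proof (rule has_sum_cong_neutral[THEN iffD1, rotated -1])
    fix k assume "k \<in> UNIV - (range p \<union> range m)"
    then have k: "k \<notin> range p" "k \<notin> range m" by auto
    have "k \<in> {- int N..int N}"
    proof (rule ccontr)
      assume "k \<notin> {- int N..int N}"
      then have "k = p (nat k - Suc N) \<or> k = m (nat (- k) - Suc N)" unfolding p_def m_def by auto
      then show False using k by auto
    qed
    then show "h k = 0" by (simp add: h_def)
  qed auto
  then show ?thesis by (simp add: h_def)
qed

text \<open>Convergence to \<open>w\<close> is not known beforehand. The majorant makes the tail of
  the formal series converge to a continuous function; together with the terms in the window it has
  the same coefficients as \<open>w\<close>, and completeness identifies the two.\<close>

lemma fourier_tail:
  assumes l: "l > 0" and c: "continuous_on UNIV w" and p: "\<And>t. w (t + l) = w t"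
    and G: "summable G" "\<And>j. 0 \<le> G j"
    and b: "\<And>k. k \<notin> {- int N..int N} \<Longrightarrow> norm (fcoef l k w) \<le> G (nat \<bar>k\<bar> - Suc N)"
  shows "((\<lambda>k. fcoef l k w * emode l k t) has_sum w t) UNIV"
    and "norm (w t - (\<Sum>k\<in>{- int N..int N}. fcoef l k w * emode l k t)) \<le> 2 * suminf G"
proof -
  define I where "I = {- int N..int N}"
  define d where "d = (\<lambda>k. if k \<in> I then 0 else fcoef l k w)"
  define h where "h = (\<lambda>k. if k \<in> I then 0 else G (nat \<bar>k\<bar> - Suc N))"
  have h: "(h has_sum 2 * suminf G) UNIV" unfolding h_def I_def by (rule int_tail_has_sum[OF G])
  have dh: "norm (d k * emode l k t) \<le> h k" for k t using b by (auto simp: d_def h_def I_def norm_mult)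
  have "(\<lambda>k. norm (d k * emode l k t)) summable_on UNIV" for t
    by (rule summable_on_comparison_test[OF has_sum_imp_summable[OF h] dh norm_ge_zero])
  then have "(\<lambda>k. d k * emode l k t) summable_on UNIV" for t by (rule abs_summable_summable)
  then have ds: "((\<lambda>k. d k * emode l k t) has_sum (\<Sum>\<^sub>\<infinity>k. d k * emode l k t)) UNIV" for t
    by (rule has_sum_infsum)
  define v where "v = (\<lambda>t. \<Sum>\<^sub>\<infinity>k. d k * emode l k t)"
  note v = fcoef_has_sum[OF l ds, folded v_def]
  define s where "s = (\<lambda>t. \<Sum>k\<in>I. fcoef l k w * emode l k t)"
  have cs: "continuous_on UNIV s" unfolding s_def by (intro continuous_intros)
  have vw: "w t - s t - v t = 0" for t
  proof (rule fcoef_zero_imp_zero[OF l])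
    show "continuous_on UNIV (\<lambda>t. w t - s t - v t)" by (intro continuous_intros c cs v)
    show "w (t + l) - s (t + l) - v (t + l) = w t - s t - v t" for t
      by (simp add: s_def v_def p emode_periodic[OF l])
    show "fcoef l k (\<lambda>t. w t - s t - v t) = 0" for k
    proof -
      have "fcoef l k s = (if k \<in> I then fcoef l k w else 0)"
        unfolding s_def by (rule fcoef_partial_sum[OF l]) (simp add: I_def)
      then show ?thesis
        by (simp add: fcoef_diff[OF continuous_on_diff[OF c cs] v(1)] fcoef_diff[OF c cs] v(2) d_def)
    qed
  qed
  have "((\<lambda>k. (if k \<in> I then fcoef l k w * emode l k t else 0) + d k * emode l k t) has_sum s t + v t) UNIV"
  proof (rule has_sum_add)
    show "((\<lambda>k. if k \<in> I then fcoef l k w * emode l k t else 0) has_sum s t) UNIV"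
      by (rule has_sum_finite_neutralI[of I]) (auto simp: I_def s_def)
    show "((\<lambda>k. d k * emode l k t) has_sum v t) UNIV" unfolding v_def by (rule ds)
  qed
  moreover have "(\<lambda>k. (if k \<in> I then fcoef l k w * emode l k t else 0) + d k * emode l k t)
      = (\<lambda>k. fcoef l k w * emode l k t)" by (auto simp: d_def)
  moreover have "s t + v t = w t" using vw[of t] by (simp add: algebra_simps)
  ultimately show "((\<lambda>k. fcoef l k w * emode l k t) has_sum w t) UNIV" by simp
  have "norm (v t) \<le> 2 * suminf G"
    unfolding v_def by (rule norm_infsum_le[OF ds h]) (rule dh)
  moreover have "v t = w t - s t" using vw[of t] by (simp add: algebra_simps)
  ultimately show "norm (w t - (\<Sum>k\<in>{- int N..int N}. fcoef l k w * emode l k t)) \<le> 2 * suminf G"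
    by (simp add: s_def I_def)
qed

section \<open>Eigenfunctions in Fermi coordinates\<close>

lemma fermi_eq_Complex: "fermi (r, t) = Complex (exp t * tanh r) (exp t / cosh r)"
  by (simp add: fermi_def complex_eq_iff exp_of_real)

lemma fermi_in_upper_half_plane [simp]: "fermi p \<in> upper_half_plane"
  by (cases p) (simp add: fermi_eq_Complex upper_half_plane_def)

lemma fermi_surj:
  assumes "z \<in> upper_half_plane"
  obtains r t where "z = fermi (r, t)"
proof
  define r where "r = arsinh (Re z / Im z)"
  have i: "Im z > 0" using assms by (simp add: upper_half_plane_def)
  have sr: "sinh r = Re z / Im z" by (simp add: r_def)
  define t where "t = ln (Im z * cosh r)"
  have e: "exp t = Im z * cosh r" using i by (simp add: t_def)
  show "z = fermi (r, t)"
    using i by (simp add: fermi_eq_Complex complex_eq_iff e tanh_def sr)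
qed

lemma fermi_shift: "fermi (r, t + l) = of_real (exp l) * fermi (r, t)"
  by (simp add: fermi_eq_Complex complex_eq_iff exp_add)

lemma continuous_on_fermi: "continuous_on S fermi"
proof -
  have eq: "fermi = (\<lambda>p. Complex (exp (snd p) * tanh (fst p)) (exp (snd p) / cosh (fst p)))"
    by (auto simp: fermi_eq_Complex)
  show ?thesis unfolding eq by (intro continuous_intros) auto
qed

text \<open>The derivative is written through the point itself: multiplied by \<open>cosh r\<close>,
  the coordinate field becomes a linear vector field on the plane, the one behind
  \<open>rot\<close>.\<close>

lemma has_vector_derivative_fermi_rho:
  "((\<lambda>r. fermi (r, t)) has_vector_derivative
     (1 / cosh r) *\<^sub>R Complex (Im (fermi (r, t))) (- Re (fermi (r, t)))) (at r)"
proof -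
  have t2: "1 - (tanh r)\<^sup>2 = 1 / (cosh r)\<^sup>2" by (simp add: tanh_def power_divide sinh_square_eq field_simps)
  have a: "((\<lambda>r. exp t * tanh r) has_real_derivative exp t / (cosh r)\<^sup>2) (at r)"
    by (auto intro!: derivative_eq_intros simp: t2)
  have b: "((\<lambda>r. exp t / cosh r) has_real_derivative - (exp t * sinh r / (cosh r)\<^sup>2)) (at r)"
    by (auto intro!: derivative_eq_intros simp: power2_eq_square)
  have "((\<lambda>r. of_real (exp t * tanh r) + of_real (exp t / cosh r) * \<i>) has_vector_derivative
      of_real (exp t / (cosh r)\<^sup>2) + of_real (- (exp t * sinh r / (cosh r)\<^sup>2)) * \<i>) (at r)"
    by (intro has_vector_derivative_add has_vector_derivative_mult_left has_vector_derivative_of_real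
        a b)
  moreover have "(\<lambda>r. of_real (exp t * tanh r) + of_real (exp t / cosh r) * \<i>) = (\<lambda>r. fermi (r, t))"
    by (simp add: fun_eq_iff fermi_eq_Complex complex_eq_iff)
  moreover have "of_real (exp t / (cosh r)\<^sup>2) + of_real (- (exp t * sinh r / (cosh r)\<^sup>2)) * \<i>
      = (1 / cosh r) *\<^sub>R Complex (Im (fermi (r, t))) (- Re (fermi (r, t)))"
    by (simp add: fermi_eq_Complex complex_eq_iff power2_eq_square tanh_def)
  ultimately show ?thesis by simp
qed

lemma has_vector_derivative_fermi_t:
  "((\<lambda>t. fermi (r, t)) has_vector_derivative fermi (r, t)) (at t)"
proof -
  have "((\<lambda>t. exp t *\<^sub>R fermi (r, 0)) has_vector_derivative exp t *\<^sub>R fermi (r, 0)) (at t)"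
    by (auto intro!: derivative_eq_intros simp: has_real_derivative_iff_has_vector_derivative[symmetric])
  moreover have "exp t *\<^sub>R fermi (r, 0) = fermi (r, t)" for t
    by (simp add: fermi_eq_Complex complex_eq_iff)
  ultimately show ?thesis by simp
qed

text \<open>The vector fields \<open>cosh \<rho> \<partial>\<^sub>\<rho>\<close> and \<open>\<partial>\<^sub>t\<close> in Cartesian coordinates.\<close>

definition rot :: "(complex \<Rightarrow> complex) \<Rightarrow> complex \<Rightarrow> complex" where
  "rot f z = of_real (Im z) * dir_deriv 1 f z - of_real (Re z) * dir_deriv \<i> f z"

definition rad :: "(complex \<Rightarrow> complex) \<Rightarrow> complex \<Rightarrow> complex" where
  "rad f z = of_real (Re z) * dir_deriv 1 f z + of_real (Im z) * dir_deriv \<i> f z"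

lemma has_derivative_dir_deriv:
  fixes f :: "complex \<Rightarrow> complex"
  assumes "f differentiable at z"
  shows "(f has_derivative (\<lambda>h. of_real (Re h) * dir_deriv 1 f z + of_real (Im h) * dir_deriv \<i> f z)) (at z)"
proof -
  have d: "(f has_derivative frechet_derivative f (at z)) (at z)" using assms by (simp add: frechet_derivative_works)
  interpret bounded_linear "frechet_derivative f (at z)" using d by (rule has_derivative_bounded_linear)
  have "frechet_derivative f (at z) h = of_real (Re h) * dir_deriv 1 f z + of_real (Im h) * dir_deriv \<i> f z" for h
  proof -
    have h: "h = Re h *\<^sub>R 1 + Im h *\<^sub>R \<i>" by (simp add: complex_eq_iff)
    have "frechet_derivative f (at z) h = frechet_derivative f (at z) (Re h *\<^sub>R 1 + Im h *\<^sub>R \<i>)"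
      by (rule arg_cong[OF h])
    also have "\<dots> = Re h *\<^sub>R frechet_derivative f (at z) 1 + Im h *\<^sub>R frechet_derivative f (at z) \<i>"
      by (simp only: add scaleR)
    finally show ?thesis by (simp only: dir_deriv_def scaleR_conv_of_real)
  qed
  then show ?thesis using d by presburger
qed

lemma dir_deriv_eqI: "(f has_derivative D) (at z) \<Longrightarrow> dir_deriv v f z = D v"
  by (simp add: dir_deriv_def frechet_derivative_at[symmetric])

lemma has_vector_derivative_compose_fermi:
  assumes "f differentiable at (fermi (r, t))"
  shows "((\<lambda>r. f (fermi (r, t))) has_vector_derivative (1 / cosh r) *\<^sub>R rot f (fermi (r, t))) (at r)"
    and "((\<lambda>t. f (fermi (r, t))) has_vector_derivative rad f (fermi (r, t))) (at t)"
proof -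
  note d = has_derivative_dir_deriv[OF assms]
  show "((\<lambda>r. f (fermi (r, t))) has_vector_derivative (1 / cosh r) *\<^sub>R rot f (fermi (r, t))) (at r)"
    using has_derivative_compose[OF has_vector_derivative_fermi_rho[unfolded has_vector_derivative_def] d]
    unfolding has_vector_derivative_def rot_def
    by (rule has_derivative_eq_rhs) (simp add: fun_eq_iff scaleR_conv_of_real algebra_simps)
  show "((\<lambda>t. f (fermi (r, t))) has_vector_derivative rad f (fermi (r, t))) (at t)"
    using has_derivative_compose[OF has_vector_derivative_fermi_t[unfolded has_vector_derivative_def] d]
    unfolding has_vector_derivative_def rad_def
    by (rule has_derivative_eq_rhs) (simp add: fun_eq_iff scaleR_conv_of_real algebra_simps)
qed

lemma has_derivative_rot_rad:
  assumes "dir_deriv 1 f differentiable at z" "dir_deriv \<i> f differentiable at z"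
  shows "(rot f has_derivative (\<lambda>h.
      of_real (Im h) * dir_deriv 1 f z
        + of_real (Im z) * (of_real (Re h) * dir_deriv 1 (dir_deriv 1 f) z + of_real (Im h) * dir_deriv \<i> (dir_deriv 1 f) z)
      - of_real (Re h) * dir_deriv \<i> f z
        - of_real (Re z) * (of_real (Re h) * dir_deriv 1 (dir_deriv \<i> f) z + of_real (Im h) * dir_deriv \<i> (dir_deriv \<i> f) z))) (at z)"
    and "(rad f has_derivative (\<lambda>h.
      of_real (Re h) * dir_deriv 1 f z
        + of_real (Re z) * (of_real (Re h) * dir_deriv 1 (dir_deriv 1 f) z + of_real (Im h) * dir_deriv \<i> (dir_deriv 1 f) z)
      + of_real (Im h) * dir_deriv \<i> f z
        + of_real (Im z) * (of_real (Re h) * dir_deriv 1 (dir_deriv \<i> f) z + of_real (Im h) * dir_deriv \<i> (dir_deriv \<i> f) z))) (at z)"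
proof -
  note d1 = has_derivative_dir_deriv[OF assms(1)] and di = has_derivative_dir_deriv[OF assms(2)]
  have re: "((\<lambda>z. complex_of_real (Re z)) has_derivative (\<lambda>h. of_real (Re h))) (at z)"
    and im: "((\<lambda>z. complex_of_real (Im z)) has_derivative (\<lambda>h. of_real (Im h))) (at z)"
    by (auto intro!: derivative_eq_intros)
  note m = has_derivative_mult[OF im d1] has_derivative_mult[OF re di] has_derivative_mult[OF re d1] has_derivative_mult[OF im di]
  show "(rot f has_derivative (\<lambda>h.
      of_real (Im h) * dir_deriv 1 f z
        + of_real (Im z) * (of_real (Re h) * dir_deriv 1 (dir_deriv 1 f) z + of_real (Im h) * dir_deriv \<i> (dir_deriv 1 f) z)
      - of_real (Re h) * dir_deriv \<i> f z
        - of_real (Re z) * (of_real (Re h) * dir_deriv 1 (dir_deriv \<i> f) z + of_real (Im h) * dir_deriv \<i> (dir_deriv \<i> f) z))) (at z)"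
    unfolding rot_def[abs_def]
    by (rule has_derivative_eq_rhs[OF has_derivative_diff[OF m(1,2)]]) (simp add: fun_eq_iff algebra_simps)
  show "(rad f has_derivative (\<lambda>h.
      of_real (Re h) * dir_deriv 1 f z
        + of_real (Re z) * (of_real (Re h) * dir_deriv 1 (dir_deriv 1 f) z + of_real (Im h) * dir_deriv \<i> (dir_deriv 1 f) z)
      + of_real (Im h) * dir_deriv \<i> f z
        + of_real (Im z) * (of_real (Re h) * dir_deriv 1 (dir_deriv \<i> f) z + of_real (Im h) * dir_deriv \<i> (dir_deriv \<i> f) z))) (at z)"
    unfolding rad_def[abs_def]
    by (rule has_derivative_eq_rhs[OF has_derivative_add[OF m(3,4)]]) (simp add: fun_eq_iff algebra_simps)
qed

text \<open>Up to sign, \<open>rot\<close> is the angular field and \<open>rad\<close> the radial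
  one, so this is the flat Laplacian in polar coordinates. In the sum the first-order terms cancel,
  and each mixed derivative occurs with both signs.\<close>

lemma rot_rot_add_rad_rad:
  assumes "dir_deriv 1 f differentiable at z" "dir_deriv \<i> f differentiable at z"
  shows "rot (rot f) z + rad (rad f) z
    = of_real ((cmod z)\<^sup>2) * (dir_deriv 1 (dir_deriv 1 f) z + dir_deriv \<i> (dir_deriv \<i> f) z)"
  unfolding rot_def[of "rot f"] rad_def[of "rad f"]
    dir_deriv_eqI[OF has_derivative_rot_rad(1)[OF assms]] dir_deriv_eqI[OF has_derivative_rot_rad(2)[OF assms]]
  unfolding cmod_power2 by (simp add: algebra_simps power2_eq_square)

text \<open>An eigenfunction in Fermi coordinates: \<open>u\<close> is the function, \<open>p = cosh \<rho> \<partial>\<^sub>\<rho> u\<close>, \<open>s = \<partial>\<^sub>t u\<close> and \<open>d = \<partial>\<^sub>t\<^sup>2 u\<close>.\<close>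

definition cyl_system ::
  "real \<Rightarrow> real \<Rightarrow> (real \<times> real \<Rightarrow> complex) \<Rightarrow> (real \<times> real \<Rightarrow> complex)
     \<Rightarrow> (real \<times> real \<Rightarrow> complex) \<Rightarrow> (real \<times> real \<Rightarrow> complex) \<Rightarrow> bool" where
  "cyl_system l lam u p s d \<longleftrightarrow>
     continuous_on UNIV u \<and> continuous_on UNIV p \<and> continuous_on UNIV s \<and> continuous_on UNIV d \<and>
     (\<forall>r t. u (r, t + l) = u (r, t) \<and> p (r, t + l) = p (r, t) \<and> s (r, t + l) = s (r, t)) \<and>
     (\<forall>r t. ((\<lambda>r. u (r, t)) has_vector_derivative (1 / cosh r) *\<^sub>R p (r, t)) (at r)) \<and>
     (\<forall>r t. ((\<lambda>r. p (r, t)) has_vector_derivative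
               (1 / cosh r) *\<^sub>R (- (lam * (cosh r)\<^sup>2) *\<^sub>R u (r, t) - d (r, t))) (at r)) \<and>
     (\<forall>r t. ((\<lambda>t. u (r, t)) has_vector_derivative s (r, t)) (at t)) \<and>
     (\<forall>r t. ((\<lambda>t. s (r, t)) has_vector_derivative d (r, t)) (at t))"

text \<open>In Fermi coordinates |z| is \<open>cosh r\<close> times \<open>Im z\<close>. With this
  the polar form of the Laplacian turns the eigenvalue equation into the one for \<open>p\<close>:
  applying \<open>cosh r\<close> d/dr twice to \<open>u\<close> gives
  \<open>- lam * (cosh r)\<^sup>2\<close> times \<open>u\<close>, minus its second derivative in
  \<open>t\<close>.\<close>

lemma eigenspace_cyl_system:
  assumes "f \<in> eigenspace l lam"
  obtains p s d where "cyl_system l lam (f \<circ> fermi) p s d"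
proof
  define H where "H = upper_half_plane"
  have inv: "\<And>z. z \<in> H \<Longrightarrow> f (of_real (exp l) * z) = f z"
    and ck: "Ck_on (Suc (Suc 0)) H f"
    and lap: "\<And>z. z \<in> H \<Longrightarrow> hyp_laplacian f z = of_real lam * f z"
    using assms by (auto simp: eigenspace_def smooth_on_def H_def simp del: Ck_on.simps)
  have df: "f differentiable at z" and d1: "dir_deriv v f differentiable at z" if "z \<in> H" for z v
    using ck that by auto
  have c2: "continuous_on H (dir_deriv v (dir_deriv w f))" for v w using ck by auto
  have c1: "continuous_on H (dir_deriv v f)" for v
    using d1 by (intro continuous_at_imp_continuous_on ballI differentiable_imp_continuous_within)
  have c0: "continuous_on H f"
    using df by (intro continuous_at_imp_continuous_on ballI differentiable_imp_continuous_within)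
  have cf: "continuous_on UNIV (g \<circ> fermi)" if "continuous_on H g" for g :: "complex \<Rightarrow> complex"
    by (rule continuous_on_compose[OF continuous_on_fermi]) (rule continuous_on_subset[OF that], auto simp: H_def)
  have fH: "fermi q \<in> H" for q by (simp add: H_def)
  have dr: "((\<lambda>r. f (fermi (r, t))) has_vector_derivative (1 / cosh r) *\<^sub>R rot f (fermi (r, t))) (at r)"
    and dt: "((\<lambda>t. f (fermi (r, t))) has_vector_derivative rad f (fermi (r, t))) (at t)" for r t
    by (intro has_vector_derivative_compose_fermi df fH)+
  have drr: "((\<lambda>r. rot f (fermi (r, t))) has_vector_derivative (1 / cosh r) *\<^sub>R rot (rot f) (fermi (r, t))) (at r)" for r t
    by (rule has_vector_derivative_compose_fermi(1), rule differentiableI, rule has_derivative_rot_rad(1)) (intro d1 fH)+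
  have dtt: "((\<lambda>t. rad f (fermi (r, t))) has_vector_derivative rad (rad f) (fermi (r, t))) (at t)" for r t
    by (rule has_vector_derivative_compose_fermi(2), rule differentiableI, rule has_derivative_rot_rad(2)) (intro d1 fH)+
  have eq: "rot (rot f) (fermi (r, t)) = - (lam * (cosh r)\<^sup>2) *\<^sub>R f (fermi (r, t)) - rad (rad f) (fermi (r, t))" for r t
  proof -
    define z where "z = fermi (r, t)"
    define A where "A = dir_deriv 1 (dir_deriv 1 f) z + dir_deriv \<i> (dir_deriv \<i> f) z"
    have zc: "(cmod z)\<^sup>2 = (cosh r)\<^sup>2 * (Im z)\<^sup>2"
      by (simp add: z_def fermi_eq_Complex cmod_power2 tanh_def power_mult_distrib power_divide sinh_square_eq field_simps)
    have "rot (rot f) z + rad (rad f) z = of_real ((cmod z)\<^sup>2) * A"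
      unfolding A_def by (rule rot_rot_add_rad_rad) (simp_all add: z_def d1 fH)
    also have "\<dots> = of_real ((cosh r)\<^sup>2) * (of_real ((Im z)\<^sup>2) * A)" unfolding zc by simp
    also have "of_real ((Im z)\<^sup>2) * A = - (of_real lam * f z)"
      using lap[of z] fH[of "(r, t)"] unfolding hyp_laplacian_def A_def z_def by (simp add: minus_equation_iff)
    finally show ?thesis unfolding z_def by (simp add: scaleR_conv_of_real algebra_simps)
  qed
  have pu: "f (fermi (r, t + l)) = f (fermi (r, t))" for r t by (simp add: fermi_shift inv fH)
  have pp: "rot f (fermi (r, t + l)) = rot f (fermi (r, t))" for r t
  proof -
    \<comment> \<open>Equal functions of \<open>r\<close> have equal derivatives, so the invariance
      of \<open>f\<close> passes to \<open>rot f\<close>.\<close>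
    have "(1 / cosh r) *\<^sub>R rot f (fermi (r, t + l)) = (1 / cosh r) *\<^sub>R rot f (fermi (r, t))"
      using vector_derivative_unique_at[OF dr[of t r] dr[of "t + l" r, unfolded pu]] by simp
    then show ?thesis by simp
  qed
  have ps: "rad f (fermi (r, t + l)) = rad f (fermi (r, t))" for r t
  proof -
    have "((\<lambda>t. t + l) has_vector_derivative 1) (at t)" by (auto intro!: derivative_eq_intros)
    from vector_diff_chain_at[OF this dt[of r "t + l"]]
    have "((\<lambda>t. f (fermi (r, t))) has_vector_derivative rad f (fermi (r, t + l))) (at t)" by (simp add: o_def pu)
    then show ?thesis using vector_derivative_unique_at dt by blast
  qed
  have crot: "continuous_on H (rot f)" "continuous_on H (rad f)"
    unfolding rot_def[abs_def] rad_def[abs_def] by (intro continuous_intros c1)+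
  have crr: "continuous_on H (rad (rad f))"
  proof -
    have "continuous_on H (dir_deriv v (rad f))" for v
    proof (rule continuous_on_eq)
      show "continuous_on H (\<lambda>z. of_real (Re v) * dir_deriv 1 f z
        + of_real (Re z) * (of_real (Re v) * dir_deriv 1 (dir_deriv 1 f) z + of_real (Im v) * dir_deriv \<i> (dir_deriv 1 f) z)
        + of_real (Im v) * dir_deriv \<i> f z
        + of_real (Im z) * (of_real (Re v) * dir_deriv 1 (dir_deriv \<i> f) z + of_real (Im v) * dir_deriv \<i> (dir_deriv \<i> f) z))"
        by (intro continuous_intros c1 c2)
    qed (rule dir_deriv_eqI[OF has_derivative_rot_rad(2), symmetric], (intro d1; assumption)+)
    then show ?thesis unfolding rad_def[of "rad f", abs_def] by (intro continuous_intros)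
  qed
  show "cyl_system l lam (f \<circ> fermi) (rot f \<circ> fermi) (rad f \<circ> fermi) (rad (rad f) \<circ> fermi)"
    unfolding cyl_system_def
  proof (intro conjI allI)
    show "((\<lambda>r. (rot f \<circ> fermi) (r, t)) has_vector_derivative
        (1 / cosh r) *\<^sub>R (- (lam * (cosh r)\<^sup>2) *\<^sub>R (f \<circ> fermi) (r, t) - (rad (rad f) \<circ> fermi) (r, t))) (at r)" for r t
      using drr[of t r] unfolding eq by simp
  qed (use pu pp ps dr dt dtt cf[OF c0] cf[OF crot(1)] cf[OF crot(2)] cf[OF crr] in simp_all)
qed

section \<open>Equations for the Fourier coefficients\<close>

lemma continuous_on_slice:
  assumes "continuous_on UNIV (w :: real \<times> real \<Rightarrow> complex)"
  shows "continuous_on S (\<lambda>t. w (r, t))"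
  by (rule continuous_on_compose2[OF assms]) (auto intro!: continuous_intros)

lemma fcoef_has_vector_derivative:
  assumes d: "\<And>r t. ((\<lambda>r. w (r, t)) has_vector_derivative w' (r, t)) (at r)"
    and c: "continuous_on UNIV w" "continuous_on UNIV w'"
  shows "((\<lambda>r. fcoef l k (\<lambda>t. w (r, t))) has_vector_derivative fcoef l k (\<lambda>t. w' (r, t))) (at r)"
proof -
  have "((\<lambda>r. integral (cbox 0 l) (\<lambda>t. w (r, t) * emode l (- k) t)) has_vector_derivative
      integral (cbox 0 l) (\<lambda>t. w' (r, t) * emode l (- k) t)) (at r within UNIV)"
  proof (rule leibniz_rule_vector_derivative)
    show "((\<lambda>r. w (r, t) * emode l (- k) t) has_vector_derivative w' (r, t) * emode l (- k) t) (at r within UNIV)" for r t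
      by (intro has_vector_derivative_mult_left d)
    show "(\<lambda>t. w (r, t) * emode l (- k) t) integrable_on cbox 0 l" for r
      by (intro integrable_continuous continuous_intros continuous_on_slice c)
    show "continuous_on (UNIV \<times> cbox 0 l) (\<lambda>(r, t). w' (r, t) * emode l (- k) t)"
      unfolding case_prod_beta prod.collapse
      by (intro continuous_intros continuous_on_subset[OF c(2)]) auto
  qed auto
  then have "((\<lambda>r. integral (cbox 0 l) (\<lambda>t. w (r, t) * emode l (- k) t) / of_real l) has_vector_derivative
      integral (cbox 0 l) (\<lambda>t. w' (r, t) * emode l (- k) t) / of_real l) (at r)"
    by (intro has_vector_derivative_divide) simp
  then show ?thesis by (simp add: fcoef_def)
qed

lemma fcoef_scaleR: "fcoef l k (\<lambda>t. c *\<^sub>R w t) = c *\<^sub>R fcoef l k w"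
  by (simp add: scaleR_conv_of_real fcoef_cmult)

text \<open>Differentiation in \<open>r\<close> passes under the integral. Two integrations by parts
  over a period express the coefficient of \<open>d\<close> through that of \<open>u\<close>, which
  turns the partial differential equation into the radial one.\<close>

lemma cyl_system_fcoef:
  assumes l: "l > 0" and cs: "cyl_system l lam u p s d"
  shows "((\<lambda>r. fcoef l k (\<lambda>t. u (r, t))) has_vector_derivative (1 / cosh r) *\<^sub>R fcoef l k (\<lambda>t. p (r, t))) (at r)"
    and "((\<lambda>r. fcoef l k (\<lambda>t. p (r, t))) has_vector_derivative
           (((2 * pi * real_of_int k / l)\<^sup>2 - lam * (cosh r)\<^sup>2) / cosh r) *\<^sub>R fcoef l k (\<lambda>t. u (r, t))) (at r)"
    and "fcoef l k (\<lambda>t. s (r, t)) = of_real (2 * pi * real_of_int k / l) * \<i> * fcoef l k (\<lambda>t. u (r, t))"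
proof -
  define kap where "kap = 2 * pi * real_of_int k / l"
  have c: "continuous_on UNIV u" "continuous_on UNIV p" "continuous_on UNIV s" "continuous_on UNIV d"
    and per: "\<And>r t. u (r, t + l) = u (r, t)" "\<And>r t. s (r, t + l) = s (r, t)"
    and dr: "\<And>r t. ((\<lambda>r. u (r, t)) has_vector_derivative (1 / cosh r) *\<^sub>R p (r, t)) (at r)"
      "\<And>r t. ((\<lambda>r. p (r, t)) has_vector_derivative
               (1 / cosh r) *\<^sub>R (- (lam * (cosh r)\<^sup>2) *\<^sub>R u (r, t) - d (r, t))) (at r)"
    and dt: "\<And>r t. ((\<lambda>t. u (r, t)) has_vector_derivative s (r, t)) (at t)"
      "\<And>r t. ((\<lambda>t. s (r, t)) has_vector_derivative d (r, t)) (at t)"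
    using cs unfolding cyl_system_def by blast+
  show su: "fcoef l k (\<lambda>t. s (r, t)) = of_real (2 * pi * real_of_int k / l) * \<i> * fcoef l k (\<lambda>t. u (r, t))" for r
    using per(1)[of r 0] by (intro fcoef_derivative l dt continuous_on_slice c) simp
  have ds: "fcoef l k (\<lambda>t. d (r, t)) = of_real (2 * pi * real_of_int k / l) * \<i> * fcoef l k (\<lambda>t. s (r, t))" for r
    using per(2)[of r 0] by (intro fcoef_derivative l dt continuous_on_slice c) simp
  have du: "fcoef l k (\<lambda>t. d (r, t)) = - (kap\<^sup>2) *\<^sub>R fcoef l k (\<lambda>t. u (r, t))" for r
    unfolding ds su kap_def by (simp add: scaleR_conv_of_real power2_eq_square mult_ac)
  have ch: "continuous_on UNIV (\<lambda>q::real \<times> real. 1 / cosh (fst q))" by (intro continuous_intros) auto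
  have "((\<lambda>r. fcoef l k (\<lambda>t. u (r, t))) has_vector_derivative
      fcoef l k (\<lambda>t. (\<lambda>q. (1 / cosh (fst q)) *\<^sub>R p q) (r, t))) (at r)"
    by (rule fcoef_has_vector_derivative) (use dr(1) in simp, intro c, intro continuous_on_scaleR ch c)
  then show "((\<lambda>r. fcoef l k (\<lambda>t. u (r, t))) has_vector_derivative (1 / cosh r) *\<^sub>R fcoef l k (\<lambda>t. p (r, t))) (at r)"
    by (simp add: fcoef_scaleR del: scaleR_scaleR)
  have "((\<lambda>r. fcoef l k (\<lambda>t. p (r, t))) has_vector_derivative
      fcoef l k (\<lambda>t. (\<lambda>q. (1 / cosh (fst q)) *\<^sub>R (- (lam * (cosh (fst q))\<^sup>2) *\<^sub>R u q - d q)) (r, t))) (at r)"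
    by (rule fcoef_has_vector_derivative) (use dr(2) in simp, intro c, intro continuous_intros ch c)
  moreover have "fcoef l k (\<lambda>t. (\<lambda>q. (1 / cosh (fst q)) *\<^sub>R (- (lam * (cosh (fst q))\<^sup>2) *\<^sub>R u q - d q)) (r, t))
      = ((kap\<^sup>2 - lam * (cosh r)\<^sup>2) / cosh r) *\<^sub>R fcoef l k (\<lambda>t. u (r, t))"
  proof -
    have "fcoef l k (\<lambda>t. - (lam * (cosh r)\<^sup>2) *\<^sub>R u (r, t) - d (r, t))
        = - (lam * (cosh r)\<^sup>2) *\<^sub>R fcoef l k (\<lambda>t. u (r, t)) - fcoef l k (\<lambda>t. d (r, t))"
      by (subst fcoef_diff) (intro continuous_intros continuous_on_slice c, intro continuous_on_slice c, simp only: fcoef_scaleR)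
    then show ?thesis unfolding fst_conv fcoef_scaleR du
      by (simp add: scaleR_conv_of_real field_simps)
  qed
  ultimately show "((\<lambda>r. fcoef l k (\<lambda>t. p (r, t))) has_vector_derivative
           (((2 * pi * real_of_int k / l)\<^sup>2 - lam * (cosh r)\<^sup>2) / cosh r) *\<^sub>R fcoef l k (\<lambda>t. u (r, t))) (at r)"
    by (simp add: kap_def)
qed

section \<open>Norms, modes and the truncation\<close>

lemma Linf_norm_le:
  assumes "\<And>r t. r \<in> I \<Longrightarrow> norm (u (r, t)) \<le> B" "0 \<le> B"
  shows "Linf_norm l I u \<le> B"
proof -
  define E where "E = esssup (cyl_area l I) (\<lambda>p. ereal (norm (u p)))"
  have "real_of_ereal E \<le> B"
  proof (cases "(\<lambda>p. ereal (norm (u p))) \<in> borel_measurable (cyl_area l I)")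
    case True
    then have "E \<le> ereal B" unfolding E_def
      by (rule esssup_I) (use assms in \<open>auto intro!: AE_I2 simp: cyl_area_def space_restrict_space\<close>)
    then show ?thesis using assms(2) by (cases E) auto
  next
    \<comment> \<open>The essential supremum of a nonmeasurable function is infinity, which
      \<open>real_of_ereal\<close> sends to 0; here \<open>0 \<le> B\<close> is what counts.\<close>
    case False
    then show ?thesis using assms(2) by (simp add: E_def esssup_non_measurable top_ereal_def)
  qed
  then show ?thesis by (simp add: Linf_norm_def E_def)
qed

lemma Linf_norm_nonneg: "0 \<le> Linf_norm l I u"
proof -
  define E where "E = esssup (cyl_area l I) (\<lambda>p. ereal (norm (u p)))"
  have "0 \<le> real_of_ereal E"
  proof (cases "(\<lambda>p. ereal (norm (u p))) \<in> borel_measurable (cyl_area l I)")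
    case True
    show ?thesis
    proof (cases "0 \<le> E")
      case True
      then show ?thesis by (rule real_of_ereal_pos)
    next
      \<comment> \<open>A negative \<open>E\<close> would be an impossible bound valid almost
        everywhere. Then every bound is valid almost everywhere, \<open>E\<close> is minus infinity,
        and its conversion to a real is 0.\<close>
      case False
      have "AE p in cyl_area l I. ereal (norm (u p)) \<le> E" unfolding E_def by (rule esssup_AE)
      then have "AE p in cyl_area l I. ereal (norm (u p)) \<le> - \<infinity>"
      proof eventually_elim
        case (elim p)
        have "0 \<le> ereal (norm (u p))" by simp
        with elim False show ?case by (meson order_trans)
      qed
      then have "E \<le> - \<infinity>" unfolding E_def by (rule esssup_I[OF True])
      then show ?thesis by simp
    qed
  next
    case False
    then show ?thesis by (simp add: E_def esssup_non_measurable top_ereal_def)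
  qed
  then show ?thesis by (simp add: Linf_norm_def E_def)
qed

text \<open>A value above the essential supremum would persist, by continuity, on a nonempty open
  set, which has positive measure. The bound \<open>B\<close> keeps \<open>E\<close> finite; an
  infinite one would be converted to 0.\<close>

lemma norm_le_Linf_norm:
  assumes l: "l > 0" and c: "continuous_on UNIV u" and b: "\<And>p. norm (u p) \<le> B"
    and per: "\<And>r t. u (r, t + l) = u (r, t)"
  shows "norm (u (r, t)) \<le> Linf_norm l UNIV u"
proof -
  define E where "E = esssup (cyl_area l UNIV) (\<lambda>p. ereal (norm (u p)))"
  have "(\<lambda>p. ereal (norm (u p))) \<in> borel_measurable borel"
    using c by (intro borel_measurable_continuous_onI continuous_on_ereal continuous_intros)
  then have meas: "(\<lambda>p. ereal (norm (u p))) \<in> borel_measurable (cyl_area l UNIV)"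
    unfolding cyl_area_def by (intro measurable_restrict_space1) simp
  have EB: "E \<le> ereal B" unfolding E_def by (rule esssup_I[OF meas]) (use b in auto)
  have S: "UNIV \<times> {0..<l} \<in> sets (borel :: (real \<times> real) measure)" by (intro borel_Times) auto
  have dm: "(\<lambda>(\<rho>, t). ennreal (cosh \<rho>)) \<in> borel_measurable (lborel :: (real \<times> real) measure)"
  proof -
    have "continuous_on UNIV (\<lambda>p::real \<times> real. cosh (fst p))" by (intro continuous_intros)
    then have "(\<lambda>p::real \<times> real. ennreal (cosh (fst p))) \<in> borel_measurable borel"
      by (intro measurable_compose[OF borel_measurable_continuous_onI measurable_ennreal])
    then show ?thesis by (simp add: case_prod_beta')
  qed
  have "AE p in cyl_area l UNIV. ereal (norm (u p)) \<le> E" unfolding E_def by (rule esssup_AE)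
  then have "AE p in density lborel (\<lambda>(\<rho>, t). ennreal (cosh \<rho>)). p \<in> UNIV \<times> {0..<l} \<longrightarrow> ereal (norm (u p)) \<le> E"
    unfolding cyl_area_def using S by (subst (asm) AE_restrict_space_iff) auto
  \<comment> \<open>The density \<open>cosh\<close> is positive, so the statement passes to Lebesgue
    measure.\<close>
  then have ae: "AE p in lborel. p \<in> UNIV \<times> {0..<l} \<longrightarrow> ereal (norm (u p)) \<le> E"
    unfolding AE_density[OF dm] by (simp add: case_prod_beta')
  have inner: "ereal (norm (u (r, t))) \<le> E" if t: "0 < t" "t < l" for r t
  proof (rule ccontr)
    assume n: "\<not> ?thesis"
    \<comment> \<open>The edge t = 0 is left out to make the set open. The edges are recovered below
      by continuity on the closure, all other \<open>t\<close> by periodicity.\<close>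
    define U where "U = {p. E < ereal (norm (u p))} \<inter> (UNIV \<times> {0<..<l})"
    have "open {p. E < ereal (norm (u p))}"
      using c by (intro open_Collect_less continuous_on_ereal continuous_intros)
    then have oU: "open U" unfolding U_def by (intro open_Int open_Times) auto
    have "(r, t) \<in> U" using n t by (simp add: U_def not_le)
    then have "\<not> negligible U" using oU by (intro open_not_negligible) auto
    moreover have "AE p in lborel. p \<notin> U" using ae by eventually_elim (auto simp: U_def)
    then have "U \<in> null_sets lborel" using oU by (subst AE_iff_null_sets) auto
    then have "U \<in> null_sets lebesgue" by (rule null_sets_completionI)
    ultimately show False by (simp add: negligible_iff_null_sets)
  qed
  have "0 \<le> ereal (norm (u (0, l / 2)))" by simp
  also have "\<dots> \<le> E" using l by (intro inner) auto
  finally have "0 \<le> E" .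
  then obtain e where e: "E = ereal e" using EB by (cases E) auto
  have "norm (u (r, t)) \<le> e" if t: "0 \<le> t" "t \<le> l" for r t
  proof (rule continuous_le_on_closure[where S = "{0<..<l}" and f = "\<lambda>t. norm (u (r, t))" and a = e])
    show "continuous_on (closure {0<..<l}) (\<lambda>t. norm (u (r, t)))"
      by (intro continuous_intros continuous_on_slice c)
    show "t \<in> closure {0<..<l}" using t l by simp
    show "norm (u (r, x)) \<le> e" if "x \<in> {0<..<l}" for x using inner[of x r] that e by simp
  qed
  moreover define n where "n = \<lfloor>t / l\<rfloor>"
  have "real_of_int n * l \<le> t" "t \<le> (real_of_int n + 1) * l"
    using l by (simp_all add: n_def pos_le_divide_eq[symmetric] pos_divide_le_eq[symmetric])
  ultimately have "norm (u (r, t - real_of_int n * l)) \<le> e" by (simp add: algebra_simps)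
  moreover have "u (r, t) = u (r, t - real_of_int n * l)"
    using periodic_add_int[of "\<lambda>t. u (r, t)" l "t - real_of_int n * l" n, OF per] by simp
  ultimately show ?thesis using e by (simp add: Linf_norm_def E_def)
qed

section \<open>Fundamental solutions and the modes\<close>

lemma wronskian_constant:
  fixes F P G Q :: "real \<Rightarrow> complex"
  assumes "\<And>r. (F has_vector_derivative a r *\<^sub>R P r) (at r)" "\<And>r. (P has_vector_derivative b r *\<^sub>R F r) (at r)"
    and "\<And>r. (G has_vector_derivative a r *\<^sub>R Q r) (at r)" "\<And>r. (Q has_vector_derivative b r *\<^sub>R G r) (at r)"
  shows "F r * Q r - P r * G r = F 0 * Q 0 - P 0 * G 0"
proof -
  have "((\<lambda>r. F r * Q r - P r * G r) has_vector_derivative 0) (at r within UNIV)" for r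
  proof -
    have "((\<lambda>r. F r * Q r - P r * G r) has_vector_derivative
        (F r * (b r *\<^sub>R G r) + (a r *\<^sub>R P r) * Q r) - (P r * (a r *\<^sub>R Q r) + (b r *\<^sub>R F r) * G r)) (at r)"
      by (intro has_vector_derivative_diff has_vector_derivative_mult assms)
    then show ?thesis by (simp add: algebra_simps)
  qed
  then obtain c where "\<And>r. r \<in> UNIV \<Longrightarrow> F r * Q r - P r * G r = c"
    using has_vector_derivative_zero_constant[of UNIV "\<lambda>r. F r * Q r - P r * G r"] by (metis convex_UNIV)
  then show ?thesis by simp
qed

text \<open>Cramer's rule: \<open>C\<close> and \<open>S\<close> have Wronskian 1, and the
  Wronskians of \<open>F\<close> with them are, up to sign, its initial data. All three are constant
  in \<open>r\<close>.\<close>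

lemma ode_solution_eq:
  fixes F P :: "real \<Rightarrow> complex"
  assumes F: "\<And>r. (F has_vector_derivative a r *\<^sub>R P r) (at r)" "\<And>r. (P has_vector_derivative b r *\<^sub>R F r) (at r)"
    and C: "\<And>r. (C has_vector_derivative a r *\<^sub>R C' r) (at r)" "\<And>r. (C' has_vector_derivative b r *\<^sub>R C r) (at r)"
    and S: "\<And>r. (S has_vector_derivative a r *\<^sub>R S' r) (at r)" "\<And>r. (S' has_vector_derivative b r *\<^sub>R S r) (at r)"
    and init: "C 0 = 1" "C' 0 = 0" "S 0 = 0" "S' 0 = 1"
  shows "F r = F 0 * C r + P 0 * S r"
proof -
  have "C r * S' r - C' r * S r = 1" using wronskian_constant[OF C S, of r] init by simp
  moreover have "F r * S' r - P r * S r = F 0" using wronskian_constant[OF F S, of r] init by simp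
  moreover have "F r * C' r - P r * C r = - P 0" using wronskian_constant[OF F C, of r] init by simp
  moreover have "F r * (C r * S' r - C' r * S r)
      = (F r * S' r - P r * S r) * C r - (F r * C' r - P r * C r) * S r" by (simp add: algebra_simps)
  ultimately show ?thesis by simp
qed

lemma cyl_systemD:
  assumes "cyl_system l lam u p s d"
  shows "continuous_on UNIV u" "continuous_on UNIV p" "continuous_on UNIV s"
    "u (r, t + l) = u (r, t)" "p (r, t + l) = p (r, t)" "s (r, t + l) = s (r, t)"
    "((\<lambda>r. u (r, t)) has_vector_derivative (1 / cosh r) *\<^sub>R p (r, t)) (at r)"
    "((\<lambda>t. u (r, t)) has_vector_derivative s (r, t)) (at t)"
  using assms unfolding cyl_system_def by blast+

lemma cyl_system_partial_rho_0: "cyl_system l lam u p s d \<Longrightarrow> partial_rho u (0, t) = p (0, t)"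
  using vector_derivative_at[OF cyl_systemD(7), of l lam u p s d t 0] by (simp add: partial_rho_def)

text \<open>The \<open>k\<close>-th coefficients of the two modes solve the radial equation with
  initial data (1, 0) and (0, 1), so they form the fundamental system that
  \<open>ode_solution_eq\<close> asks for.\<close>

lemma mode_fcoef_basis:
  assumes l: "l > 0"
    and phi: "is_phi_mode l lam k g" and psi: "is_psi_mode l lam k h"
    and cs: "cyl_system l lam u p s d"
  shows "fcoef l k (\<lambda>t. u (r, t))
    = fcoef l k (\<lambda>t. u (0, t)) * fcoef l k (\<lambda>t. g (fermi (r, t)))
    + fcoef l k (\<lambda>t. p (0, t)) * fcoef l k (\<lambda>t. h (fermi (r, t)))"
proof -
  obtain pc sc dc where c: "cyl_system l lam (g \<circ> fermi) pc sc dc"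
    using phi eigenspace_cyl_system unfolding is_phi_mode_def by metis
  obtain ps ss ds where s: "cyl_system l lam (h \<circ> fermi) ps ss ds"
    using psi eigenspace_cyl_system unfolding is_psi_mode_def by metis
  have 0: "g (fermi (0, t)) = 1 * emode l k t" "pc (0, t) = 0 * emode l k t"
    "h (fermi (0, t)) = 0 * emode l k t" "ps (0, t) = 1 * emode l k t" for t
    using phi psi cyl_system_partial_rho_0[OF c, of t] cyl_system_partial_rho_0[OF s, of t]
    by (auto simp: is_phi_mode_def is_psi_mode_def emode_eq_exp)
  have i: "fcoef l k (\<lambda>t. (g \<circ> fermi) (0, t)) = 1" "fcoef l k (\<lambda>t. pc (0, t)) = 0"
    "fcoef l k (\<lambda>t. (h \<circ> fermi) (0, t)) = 0" "fcoef l k (\<lambda>t. ps (0, t)) = 1"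
    by (simp_all only: o_def 0 fcoef_emode[OF l] simp_thms if_True)
  show ?thesis
    using ode_solution_eq[OF cyl_system_fcoef(1,2)[OF l cs] cyl_system_fcoef(1,2)[OF l c]
        cyl_system_fcoef(1,2)[OF l s] i, of r] by simp
qed

text \<open>The modes are specified by the equation and their data at rho = 0. For
  \<open>j \<noteq> k\<close> the \<open>j\<close>-th coefficient has zero data and so vanishes for
  all \<open>r\<close>; by completeness only the \<open>k\<close>-th exponential is left.\<close>

lemma mode_eq_emode:
  assumes l: "l > 0"
    and phi: "\<And>k. is_phi_mode l lam k (\<phi> k)" and psi: "\<And>k. is_psi_mode l lam k (\<psi> k)"
  shows "\<phi> k (fermi (r, t)) = fcoef l k (\<lambda>t. \<phi> k (fermi (r, t))) * emode l k t"
    and "\<psi> k (fermi (r, t)) = fcoef l k (\<lambda>t. \<psi> k (fermi (r, t))) * emode l k t"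
proof -
  have gen: "w (fermi (r, t)) = fcoef l k (\<lambda>t. w (fermi (r, t))) * emode l k t"
    if w: "w \<in> eigenspace l lam" and w0: "\<And>t. w (fermi (0, t)) = a * emode l k t"
      and w1: "\<And>t. partial_rho (w \<circ> fermi) (0, t) = b * emode l k t" for w a b
  proof -
    obtain p s d where cs: "cyl_system l lam (w \<circ> fermi) p s d" using eigenspace_cyl_system[OF w] by blast
    have p0: "p (0, t) = b * emode l k t" for t using cyl_system_partial_rho_0[OF cs] w1 by simp
    have z: "fcoef l j (\<lambda>t. (w \<circ> fermi) (r, t)) = 0" if "j \<noteq> k" for j
    proof -
      have "fcoef l j (\<lambda>t. (w \<circ> fermi) (0, t)) = 0" "fcoef l j (\<lambda>t. p (0, t)) = 0"
        using that by (simp_all only: o_def p0 w0 fcoef_emode[OF l] if_False)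
      then show ?thesis by (subst mode_fcoef_basis[OF l phi psi cs]) simp
    qed
    have c: "continuous_on UNIV (\<lambda>t. (w \<circ> fermi) (r, t))" by (rule continuous_on_slice[OF cyl_systemD(1)[OF cs]])
    define q where "q = fcoef l k (\<lambda>t. (w \<circ> fermi) (r, t))"
    have ce: "continuous_on UNIV (\<lambda>t. q * emode l k t)" by (intro continuous_intros)
    have "(w \<circ> fermi) (r, t) - q * emode l k t = 0"
    proof (rule fcoef_zero_imp_zero[OF l])
      show "continuous_on UNIV (\<lambda>t. (w \<circ> fermi) (r, t) - q * emode l k t)" by (rule continuous_on_diff[OF c ce])
      show "(w \<circ> fermi) (r, t + l) - q * emode l k (t + l) = (w \<circ> fermi) (r, t) - q * emode l k t" for t
        using cyl_systemD(4)[OF cs] emode_periodic[OF l] by simp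
      show "fcoef l j (\<lambda>t. (w \<circ> fermi) (r, t) - q * emode l k t) = 0" for j
        unfolding fcoef_diff[OF c ce] fcoef_emode[OF l] using z[of j] q_def by auto
    qed
    then show ?thesis by (simp add: q_def)
  qed
  show "\<phi> k (fermi (r, t)) = fcoef l k (\<lambda>t. \<phi> k (fermi (r, t))) * emode l k t"
    by (rule gen[of _ 1 0]) (use phi[of k] in \<open>auto simp: is_phi_mode_def emode_eq_exp\<close>)
  show "\<psi> k (fermi (r, t)) = fcoef l k (\<lambda>t. \<psi> k (fermi (r, t))) * emode l k t"
    by (rule gen[of _ 0 1]) (use psi[of k] in \<open>auto simp: is_psi_mode_def emode_eq_exp\<close>)
qed

section \<open>Tail bounds and convergence on the circles of constant rho\<close>

lemma cyl_system_tail: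
  assumes l: "l > 0" and lam: "lam > 0" and L: "0 \<le> L" "lam * (cosh L)\<^sup>2 < (2 * pi * real (N + 1) / l)\<^sup>2"
    and cs: "cyl_system l lam u p s d" and bd: "\<And>q. norm (u q) \<le> M" and r: "\<bar>r\<bar> \<le> L"
  defines "F \<equiv> \<lambda>k. fcoef l k (\<lambda>t. u (r, t))" and "P \<equiv> \<lambda>k. fcoef l k (\<lambda>t. p (r, t))"
    and "kap \<equiv> \<lambda>j. 2 * pi * real (N + 1 + j) / l"
  shows "((\<lambda>k. F k * emode l k t) has_sum u (r, t)) UNIV"
    and "norm (u (r, t) - (\<Sum>k\<in>{- int N..int N}. F k * emode l k t))
      \<le> 4 * (\<Sum>j. 1 / cosh (phase (kap j) lam L)) * M"
    and "norm (s (r, t) - (\<Sum>k\<in>{- int N..int N}. of_real (2 * pi * real_of_int k / l) * \<i> * F k * emode l k t))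
      \<le> 4 * (\<Sum>j. kap j * (1 / cosh (phase (kap j) lam L))) * M"
    and "norm (p (r, t) - (\<Sum>k\<in>{- int N..int N}. P k * emode l k t))
      \<le> 4 * (\<Sum>j. sqrt ((kap j)\<^sup>2 - lam * (cosh L)\<^sup>2) * (1 / sinh (phase (kap j) lam L))) * M"
proof -
  have M0: "0 \<le> M" using bd norm_ge_zero order_trans by blast
  have kp: "0 < kap j" for j using l by (simp add: kap_def)
  have kL: "lam * (cosh L)\<^sup>2 < (kap j)\<^sup>2" for j
  proof -
    have "2 * pi * real (N + 1) / l \<le> kap j" using l unfolding kap_def by (intro divide_right_mono mult_left_mono) auto
    then have "(2 * pi * real (N + 1) / l)\<^sup>2 \<le> (kap j)\<^sup>2" using l by (intro power_mono) auto
    then show ?thesis using L by linarith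
  qed
  define x1 where "x1 = (\<lambda>j. 1 / cosh (phase (kap j) lam L))"
  define x2 where "x2 = (\<lambda>j. kap j * (1 / cosh (phase (kap j) lam L)))"
  define x3 where "x3 = (\<lambda>j. sqrt ((kap j)\<^sup>2 - lam * (cosh L)\<^sup>2) * (1 / sinh (phase (kap j) lam L)))"
  note sb = phase_series_bounds[OF lam kp L(1) kL]
  have sm: "summable (\<lambda>j. (1 + kap j) / sinh (phase (kap j) lam L))"
    unfolding kap_def by (rule summable_phase[OF l lam L(1)]) (use L in auto)
  have pos: "0 \<le> x1 j" "0 \<le> x2 j" "0 \<le> x3 j" for j unfolding x1_def x2_def x3_def by (rule sb)+
  have "norm (x1 j) \<le> (1 + kap j) / sinh (phase (kap j) lam L)" for j
    using pos(1)[of j] sb(2)[of j] by (simp only: real_norm_def abs_of_nonneg x1_def)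
  then have s1: "summable x1" by (rule summable_comparison_test'[OF sm])
  have "norm (x2 j) \<le> (1 + kap j) / sinh (phase (kap j) lam L)" for j
    using pos(2)[of j] sb(4)[of j] by (simp only: real_norm_def abs_of_nonneg x2_def)
  then have s2: "summable x2" by (rule summable_comparison_test'[OF sm])
  have "norm (x3 j) \<le> (1 + kap j) / sinh (phase (kap j) lam L)" for j
    using pos(3)[of j] sb(6)[of j] by (simp only: real_norm_def abs_of_nonneg x3_def)
  then have s3: "summable x3" by (rule summable_comparison_test'[OF sm])
  \<comment> \<open>\<open>F\<close> and \<open>P\<close> have separate bounds from the radial
    equation; differentiation in \<open>t\<close> multiplies \<open>F k\<close> by a number of
    modulus \<open>kap j\<close>.\<close>
  have b: "norm (F k) \<le> 2 * M * x1 (nat \<bar>k\<bar> - Suc N)"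
    "norm (of_real (2 * pi * real_of_int k / l) * \<i> * F k) \<le> 2 * M * x2 (nat \<bar>k\<bar> - Suc N)"
    "norm (P k) \<le> 2 * M * x3 (nat \<bar>k\<bar> - Suc N)" if k: "k \<notin> {- int N..int N}" for k
  proof -
    define j where "j = nat \<bar>k\<bar> - Suc N"
    \<comment> \<open>The radial equation contains only the square of the frequency, so
      \<open>k\<close> and \<open>- k\<close> share the majorant with index
      \<open>j\<close>.\<close>
    have "real (N + 1 + j) = \<bar>real_of_int k\<bar>" using k unfolding j_def by auto
    then have kj: "kap j = \<bar>2 * pi * real_of_int k / l\<bar>" using l by (simp add: kap_def abs_mult)
    then have kj2: "(kap j)\<^sup>2 = (2 * pi * real_of_int k / l)\<^sup>2" by (simp only: power2_abs)
    note ode = cyl_system_fcoef(1,2)[OF l cs, of k, folded kj2]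
    have fb: "norm (fcoef l k (\<lambda>t. u (r, t))) \<le> M" for r
      by (rule norm_fcoef_le[OF l continuous_on_slice[OF cyl_systemD(1)[OF cs]] bd])
    note B = ode_bound_general[OF lam kp L(1) kL ode fb r]
    show 1: "norm (F k) \<le> 2 * M * x1 (nat \<bar>k\<bar> - Suc N)" using B(1) by (simp add: x1_def j_def F_def)
    have "norm (of_real (2 * pi * real_of_int k / l) * \<i> * F k) = kap j * norm (F k)"
      unfolding kj norm_mult norm_of_real by simp
    also have "\<dots> \<le> kap j * (2 * M * x1 j)" using 1 less_imp_le[OF kp] unfolding j_def by (rule mult_left_mono)
    also have "\<dots> = 2 * M * x2 j" by (simp add: x1_def x2_def)
    finally show "norm (of_real (2 * pi * real_of_int k / l) * \<i> * F k) \<le> 2 * M * x2 (nat \<bar>k\<bar> - Suc N)"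
      by (simp add: j_def)
    show "norm (P k) \<le> 2 * M * x3 (nat \<bar>k\<bar> - Suc N)" using B(2) by (simp add: x3_def j_def P_def)
  qed
  \<comment> \<open>The 4 is the product of the 2 from the even and odd parts and the 2 from the
    signs of \<open>k\<close>.\<close>
  have sn: "summable (\<lambda>j. 2 * M * x j)" "2 * (\<Sum>j. 2 * M * x j) = 4 * suminf x * M" if "summable x" for x :: "nat \<Rightarrow> real"
    using that by (simp_all add: summable_mult suminf_mult)
  have nn: "0 \<le> 2 * M * x1 j" "0 \<le> 2 * M * x2 j" "0 \<le> 2 * M * x3 j" for j using M0 pos[of j] by simp_all
  note c = continuous_on_slice[OF cyl_systemD(1)[OF cs]] continuous_on_slice[OF cyl_systemD(3)[OF cs]]
    continuous_on_slice[OF cyl_systemD(2)[OF cs]]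
  note per = cyl_systemD(4-6)[OF cs]
  note T1 = fourier_tail[OF l c(1) per(1) sn(1)[OF s1] nn(1) b(1)[unfolded F_def]]
  show "((\<lambda>k. F k * emode l k t) has_sum u (r, t)) UNIV" unfolding F_def by (rule T1(1))
  show "norm (u (r, t) - (\<Sum>k\<in>{- int N..int N}. F k * emode l k t))
      \<le> 4 * (\<Sum>j. 1 / cosh (phase (kap j) lam L)) * M"
    using T1(2)[of t] unfolding sn(2)[OF s1] unfolding x1_def F_def .
  have fs: "fcoef l k (\<lambda>t. s (r, t)) = of_real (2 * pi * real_of_int k / l) * \<i> * F k" for k
    unfolding F_def by (rule cyl_system_fcoef(3)[OF l cs])
  note T2 = fourier_tail(2)[OF l c(2) per(3) sn(1)[OF s2] nn(2) b(2)[folded fs]]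
  show "norm (s (r, t) - (\<Sum>k\<in>{- int N..int N}. of_real (2 * pi * real_of_int k / l) * \<i> * F k * emode l k t))
      \<le> 4 * (\<Sum>j. kap j * (1 / cosh (phase (kap j) lam L))) * M"
    using T2[of t] unfolding sn(2)[OF s2] fs unfolding x2_def .
  note T3 = fourier_tail(2)[OF l c(3) per(2) sn(1)[OF s3] nn(3) b(3)[unfolded P_def]]
  show "norm (p (r, t) - (\<Sum>k\<in>{- int N..int N}. P k * emode l k t))
      \<le> 4 * (\<Sum>j. sqrt ((kap j)\<^sup>2 - lam * (cosh L)\<^sup>2) * (1 / sinh (phase (kap j) lam L))) * M"
    using T3[of t] unfolding sn(2)[OF s3] unfolding x3_def P_def .
qed

text \<open>For given \<open>r\<close> the window is taken so large that every frequency outside it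
  has its turning point beyond |r|; then \<open>cyl_system_tail\<close> applies with |r| as
  \<open>L\<close>. The window depends on \<open>r\<close>, the sum does not.\<close>

lemma cyl_system_has_sum:
  assumes l: "l > 0" and lam: "lam > 0"
    and cs: "cyl_system l lam u p s d" and bd: "\<And>q. norm (u q) \<le> M"
  shows "((\<lambda>k. fcoef l k (\<lambda>t. u (r, t)) * emode l k t) has_sum u (r, t)) UNIV"
proof -
  obtain N :: nat where N: "real N > l * (sqrt lam * cosh r) / (2 * pi)" using reals_Archimedean2 by blast
  then have "l * (sqrt lam * cosh r) < 2 * pi * real N" by (simp add: divide_less_eq mult.commute)
  also have "\<dots> \<le> 2 * pi * real (N + 1)" by simp
  finally have "l * (sqrt lam * cosh r) < 2 * pi * real (N + 1)" .
  then have "sqrt lam * cosh r < 2 * pi * real (N + 1) / l" using l by (simp add: pos_less_divide_eq mult.commute)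
  then have "(sqrt lam * cosh r)\<^sup>2 < (2 * pi * real (N + 1) / l)\<^sup>2"
    using lam by (intro power_strict_mono) auto
  then have "lam * (cosh \<bar>r\<bar>)\<^sup>2 < (2 * pi * real (N + 1) / l)\<^sup>2"
    using lam by (simp add: power_mult_distrib abs_if)
  from cyl_system_tail(1)[OF l lam abs_ge_zero this cs bd order_refl] show ?thesis .
qed

text \<open>\<open>fourier_coeffs\<close> is a definite description, so existence and uniqueness are
  both due. Existence is the Fourier series on each circle, rewritten in the modes; uniqueness
  compares coefficients on the circles as functions of \<open>r\<close>.\<close>

lemma fourier_coeffs_eq:
  assumes l: "l > 0" and lam: "lam > 0"
    and phi: "\<And>k. is_phi_mode l lam k (\<phi> k)" and psi: "\<And>k. is_psi_mode l lam k (\<psi> k)"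
    and cs: "cyl_system l lam (f \<circ> fermi) p s d" and bd: "\<And>q. norm ((f \<circ> fermi) q) \<le> M"
  shows "fourier_coeffs \<phi> \<psi> f
    = ((\<lambda>k. fcoef l k (\<lambda>t. (f \<circ> fermi) (0, t))), (\<lambda>k. fcoef l k (\<lambda>t. p (0, t))))"
proof -
  define a b where "a = (\<lambda>k. fcoef l k (\<lambda>t. (f \<circ> fermi) (0, t)))" and "b = (\<lambda>k. fcoef l k (\<lambda>t. p (0, t)))"
  define C S where "C k r = fcoef l k (\<lambda>t. \<phi> k (fermi (r, t)))"
    and "S k r = fcoef l k (\<lambda>t. \<psi> k (fermi (r, t)))" for k r
  have e: "\<phi> k (fermi (r, t)) = C k r * emode l k t" "\<psi> k (fermi (r, t)) = S k r * emode l k t" for k r t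
    unfolding C_def S_def by (rule mode_eq_emode[OF l phi psi])+
  have F: "fcoef l k (\<lambda>t. (f \<circ> fermi) (r, t)) = a k * C k r + b k * S k r" for k r
    unfolding a_def b_def C_def S_def by (rule mode_fcoef_basis[OF l phi psi cs])
  have sum: "((\<lambda>k. a k * \<phi> k z + b k * \<psi> k z) has_sum f z) UNIV" if zH: "z \<in> upper_half_plane" for z
  proof -
    obtain r t where z: "z = fermi (r, t)" using fermi_surj[OF zH] by blast
    have "(\<lambda>k. a k * \<phi> k z + b k * \<psi> k z) = (\<lambda>k. fcoef l k (\<lambda>t. (f \<circ> fermi) (r, t)) * emode l k t)"
      unfolding F z e by (simp add: algebra_simps)
    then show ?thesis using cyl_system_has_sum[OF l lam cs bd, of r t] by (simp add: z)
  qed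
  have uniq: "a' = a \<and> b' = b" if s: "\<And>z. z \<in> upper_half_plane \<Longrightarrow> ((\<lambda>k. a' k * \<phi> k z + b' k * \<psi> k z) has_sum f z) UNIV" for a' b'
  proof -
    have eq: "a' k * C k r + b' k * S k r = a k * C k r + b k * S k r" for k r
    proof -
      have "((\<lambda>k. (a' k * C k r + b' k * S k r) * emode l k t) has_sum (f \<circ> fermi) (r, t)) UNIV" for t
      proof -
        have "(\<lambda>k. a' k * \<phi> k (fermi (r, t)) + b' k * \<psi> k (fermi (r, t)))
            = (\<lambda>k. (a' k * C k r + b' k * S k r) * emode l k t)"
          unfolding e by (simp add: algebra_simps)
        then show ?thesis using s[of "fermi (r, t)"] by simp
      qed
      from fcoef_has_sum(2)[OF l this] show ?thesis using F by simp
    qed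
    have C0: "C k 0 = 1" and S0: "S k 0 = 0" for k
      using e[of k 0 0] phi[of k] psi[of k] by (auto simp: is_phi_mode_def is_psi_mode_def dest!: spec[of _ "0::real"])
    have a: "a' k = a k" for k using eq[of k 0] by (simp add: C0 S0)
    \<comment> \<open>Otherwise the radial factor of \<open>\<psi> k\<close> would vanish
      identically, against its derivative 1 at rho = 0.\<close>
    have "b' k = b k" for k
    proof (rule ccontr)
      assume n: "b' k \<noteq> b k"
      have "S k r = 0" for r using eq[of k r] n by (simp add: a)
      then have z: "\<psi> k (fermi (r, 0)) = 0" for r using e(2)[of k r 0] by simp
      have "partial_rho (\<psi> k \<circ> fermi) (0, 0) = vector_derivative (\<lambda>r. 0) (at (0::real))"
        by (simp add: partial_rho_def z)
      moreover have "partial_rho (\<psi> k \<circ> fermi) (0, 0) = 1" using psi[of k] by (simp add: is_psi_mode_def)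
      ultimately show False by simp
    qed
    with a show ?thesis by auto
  qed
  have "fourier_coeffs \<phi> \<psi> f = (a, b)"
    unfolding fourier_coeffs_def
  proof (rule the_equality)
    show "case (a, b) of (a, b) \<Rightarrow> \<forall>z\<in>upper_half_plane. ((\<lambda>k. a k * \<phi> k z + b k * \<psi> k z) has_sum f z) UNIV"
      using sum by simp
    show "x = (a, b)" if "case x of (a, b) \<Rightarrow> \<forall>z\<in>upper_half_plane. ((\<lambda>k. a k * \<phi> k z + b k * \<psi> k z) has_sum f z) UNIV" for x
      using that uniq[of "fst x" "snd x"] by (cases x) auto
  qed
  then show ?thesis by (simp add: a_def b_def)
qed

text \<open>On each circle the truncation is a partial sum of the ordinary Fourier series, so the
  remainder is a tail to which \<open>cyl_system_tail\<close> applies.\<close>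

lemma truncation_eq:
  assumes l: "l > 0" and lam: "lam > 0"
    and phi: "\<And>k. is_phi_mode l lam k (\<phi> k)" and psi: "\<And>k. is_psi_mode l lam k (\<psi> k)"
    and cs: "cyl_system l lam (f \<circ> fermi) p s d" and bd: "\<And>q. norm ((f \<circ> fermi) q) \<le> M"
  shows "truncation \<phi> \<psi> N f (fermi (r, t))
    = (\<Sum>k\<in>{- int N..int N}. fcoef l k (\<lambda>t. (f \<circ> fermi) (r, t)) * emode l k t)"
  unfolding truncation_def fourier_coeffs_eq[OF l lam phi psi cs bd] prod.case
proof (rule sum.cong[OF refl])
  fix k
  show "fcoef l k (\<lambda>t. (f \<circ> fermi) (0, t)) * \<phi> k (fermi (r, t)) + fcoef l k (\<lambda>t. p (0, t)) * \<psi> k (fermi (r, t))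
      = fcoef l k (\<lambda>t. (f \<circ> fermi) (r, t)) * emode l k t"
    unfolding mode_fcoef_basis[OF l phi[of k] psi[of k] cs, of r]
    by (subst mode_eq_emode(1)[OF l phi psi], subst mode_eq_emode(2)[OF l phi psi]) (simp add: algebra_simps)
qed

text \<open>Taking coefficients commutes with both derivatives, so the derivatives of the remainder
  are themselves remainders, of \<open>s\<close> and of \<open>p\<close> over \<open>cosh r\<close>,
  and each is estimated as a tail of its own.\<close>

lemma cyl_remainder_derivatives:
  assumes l: "l > 0" and cs: "cyl_system l lam u p s d" and A: "finite A"
    and v: "\<And>r t. v (r, t) = u (r, t) - (\<Sum>k\<in>A. fcoef l k (\<lambda>t. u (r, t)) * emode l k t)"
  shows "partial_t v (r, t)
      = s (r, t) - (\<Sum>k\<in>A. of_real (2 * pi * real_of_int k / l) * \<i> * fcoef l k (\<lambda>t. u (r, t)) * emode l k t)"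
    and "partial_rho v (r, t)
      = (1 / cosh r) *\<^sub>R (p (r, t) - (\<Sum>k\<in>A. fcoef l k (\<lambda>t. p (r, t)) * emode l k t))"
proof -
  have "((\<lambda>t. v (r, t)) has_vector_derivative
      s (r, t) - (\<Sum>k\<in>A. fcoef l k (\<lambda>t. u (r, t)) * (of_real (2 * pi * real_of_int k / l) * \<i> * emode l k t))) (at t)"
    unfolding v by (intro has_vector_derivative_diff cyl_systemD(8)[OF cs] has_vector_derivative_sum
        has_vector_derivative_mult_right has_vector_derivative_emode)
  from vector_derivative_at[OF this]
  show "partial_t v (r, t)
      = s (r, t) - (\<Sum>k\<in>A. of_real (2 * pi * real_of_int k / l) * \<i> * fcoef l k (\<lambda>t. u (r, t)) * emode l k t)"
    unfolding partial_t_def by (simp add: mult_ac)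
  have "((\<lambda>r. v (r, t)) has_vector_derivative
      (1 / cosh r) *\<^sub>R p (r, t) - (\<Sum>k\<in>A. (1 / cosh r) *\<^sub>R fcoef l k (\<lambda>t. p (r, t)) * emode l k t)) (at r)"
    unfolding v by (intro has_vector_derivative_diff cyl_systemD(7)[OF cs] has_vector_derivative_sum
        has_vector_derivative_mult_left cyl_system_fcoef(1)[OF l cs])
  from vector_derivative_at[OF this]
  show "partial_rho v (r, t)
      = (1 / cosh r) *\<^sub>R (p (r, t) - (\<Sum>k\<in>A. fcoef l k (\<lambda>t. p (r, t)) * emode l k t))"
    unfolding partial_rho_def by (simp add: scaleR_diff_right scaleR_sum_right)
qed

theorem theorem4p2:
  fixes l lam L \<phi>0 :: real and N :: nat
    and f :: "complex \<Rightarrow> complex"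
    and \<phi> \<psi> :: "int \<Rightarrow> complex \<Rightarrow> complex"
  assumes "l > 0" and "lam > 0" and "L > 0" and "N > 0"
    and "\<And>k. is_phi_mode l lam k (\<phi> k)"
    and "\<And>k. is_psi_mode l lam k (\<psi> k)"
    and "f \<in> eigenspace l lam"
    and "bounded (f ` upper_half_plane)"
    and "\<phi>0 = 2 * arctan (tanh (L / 2))"
    and "4 * pi\<^sup>2 * (real N)\<^sup>2 / (l\<^sup>2 * (cosh L)\<^sup>2) > lam"
  shows "Linf_norm l {-L..L} ((\<lambda>z. f z - truncation \<phi> \<psi> N f z) \<circ> fermi)
           \<le> beta_tilde l lam \<phi>0 N * Linf_norm l UNIV (f \<circ> fermi)
       \<and> C1_norm l {-L..L} ((\<lambda>z. f z - truncation \<phi> \<psi> N f z) \<circ> fermi)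
           \<le> beta l lam \<phi>0 N * Linf_norm l UNIV (f \<circ> fermi)"
proof -
  note l = assms(1) and lam = assms(2) and L = assms(3) and phi = assms(5) and psi = assms(6)
  obtain p s d where cs: "cyl_system l lam (f \<circ> fermi) p s d" using eigenspace_cyl_system[OF assms(7)] by blast
  obtain B where "\<And>z. z \<in> upper_half_plane \<Longrightarrow> norm (f z) \<le> B" using assms(8) by (auto simp: bounded_iff)
  then have bdB: "norm ((f \<circ> fermi) q) \<le> B" for q by simp
  define M where "M = Linf_norm l UNIV (f \<circ> fermi)"
  have M0: "0 \<le> M" unfolding M_def by (rule Linf_norm_nonneg)
  \<comment> \<open>The arbitrary bound \<open>B\<close> serves to identify the essential supremum
    as a pointwise bound, which is what the radial estimates need.\<close>
  have bd: "norm ((f \<circ> fermi) q) \<le> M" for q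
    using norm_le_Linf_norm[OF l cyl_systemD(1)[OF cs] bdB cyl_systemD(4)[OF cs]] unfolding M_def by (cases q) (simp only:)
  \<comment> \<open>In other words, the turning point of every frequency from \<open>N\<close> on
    lies beyond \<open>L\<close>.\<close>
  have kN: "lam * (cosh L)\<^sup>2 < (2 * pi * real k / l)\<^sup>2" if "k \<ge> N" for k
  proof -
    have "0 < l\<^sup>2 * (cosh L)\<^sup>2" using l by simp
    then have "lam * (l\<^sup>2 * (cosh L)\<^sup>2) < 4 * pi\<^sup>2 * (real N)\<^sup>2" using assms(10) by (simp only: pos_less_divide_eq)
    then have "lam * (cosh L)\<^sup>2 < 4 * pi\<^sup>2 * (real N)\<^sup>2 / l\<^sup>2" using l by (simp add: pos_less_divide_eq mult_ac)
    also have "\<dots> = (2 * pi * real N / l)\<^sup>2" by (simp add: power_divide power_mult_distrib)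
    also have "\<dots> \<le> (2 * pi * real k / l)\<^sup>2"
      using l that by (intro power_mono divide_right_mono mult_left_mono) auto
    finally show ?thesis .
  qed
  have ck: "ck l lam (N + 1 + j) \<phi>0 = phase (2 * pi * real (N + 1 + j) / l) lam L" for j
    by (rule ck_eq_phase(1)[OF l lam _ kN assms(9)]) auto
  have cos0: "cos \<phi>0 = 1 / cosh L" by (rule ck_eq_phase(2)[OF l lam assms(4) kN assms(9)]) simp
  have A1: "A1 l lam \<phi>0 N = 4 * (\<Sum>j. 1 / cosh (phase (2 * pi * real (N + 1 + j) / l) lam L))"
    unfolding A1_def Let_def ck ..
  have A2: "A2 l lam \<phi>0 N = 4 * (\<Sum>j. 2 * pi * real (N + 1 + j) / l * (1 / cosh (phase (2 * pi * real (N + 1 + j) / l) lam L)))"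
    unfolding A2_def Let_def ck ..
  have "4 * pi\<^sup>2 * (real k)\<^sup>2 / l\<^sup>2 - lam / (cos \<phi>0)\<^sup>2 = (2 * pi * real k / l)\<^sup>2 - lam * (cosh L)\<^sup>2" for k
    unfolding cos0 by (simp add: power_divide power_mult_distrib)
  then have A3: "A3 l lam \<phi>0 N = 4 * (\<Sum>j. sqrt ((2 * pi * real (N + 1 + j) / l)\<^sup>2 - lam * (cosh L)\<^sup>2)
      * (1 / sinh (phase (2 * pi * real (N + 1 + j) / l) lam L)))"
    unfolding A3_def Let_def ck by (simp only:)
  define v where "v = (\<lambda>z. f z - truncation \<phi> \<psi> N f z) \<circ> fermi"
  have v: "v (r, t) = (f \<circ> fermi) (r, t) - (\<Sum>k\<in>{- int N..int N}. fcoef l k (\<lambda>t. (f \<circ> fermi) (r, t)) * emode l k t)" for r t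
    unfolding v_def using truncation_eq[OF l lam phi psi cs bd, of N r t] by simp
  note dv = cyl_remainder_derivatives[OF l cs finite_atLeastAtMost_int v]
  have L0: "0 \<le> L" using L by simp
  have kN1: "lam * (cosh L)\<^sup>2 < (2 * pi * real (N + 1) / l)\<^sup>2" by (rule kN) simp
  have b: "norm (v (r, t)) \<le> A1 l lam \<phi>0 N * M"
    "norm (partial_t v (r, t)) \<le> A2 l lam \<phi>0 N * M"
    "norm (cosh r *\<^sub>R partial_rho v (r, t)) \<le> A3 l lam \<phi>0 N * M" if "r \<in> {-L..L}" for r t
  proof -
    have r: "\<bar>r\<bar> \<le> L" using that by auto
    note T = cyl_system_tail(2-4)[OF l lam L0 kN1 cs bd r, of t]
    show "norm (v (r, t)) \<le> A1 l lam \<phi>0 N * M" unfolding v A1 by (rule T(1))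
    show "norm (partial_t v (r, t)) \<le> A2 l lam \<phi>0 N * M" unfolding dv(1) A2 by (rule T(2))
    show "norm (cosh r *\<^sub>R partial_rho v (r, t)) \<le> A3 l lam \<phi>0 N * M"
      unfolding dv(2) A3 using T(3) by simp
  qed
  have pos: "0 \<le> A1 l lam \<phi>0 N * M" "0 \<le> A2 l lam \<phi>0 N * M" "0 \<le> A3 l lam \<phi>0 N * M"
    using b[of 0 0] L by (auto intro: order_trans[OF norm_ge_zero])
  \<comment> \<open>The tail bounds concern the \<open>t\<close>-derivative and
    \<open>cosh r\<close> times the \<open>r\<close>-derivative of \<open>v\<close>. As
    \<open>cosh r\<close> is at least 1, the division by it that leads to the terms of the norm
    keeps the bounds.\<close>
  have le_div: "x / cosh r \<le> y" if "x \<le> y" "0 \<le> x" for x y r :: real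
  proof -
    have "x / cosh r \<le> x / 1" using that(2) cosh_real_ge_1[of r] by (intro divide_left_mono) auto
    then show ?thesis using that(1) by simp
  qed
  have n1: "Linf_norm l {-L..L} v \<le> A1 l lam \<phi>0 N * M"
    by (rule Linf_norm_le) (rule b(1), assumption, rule pos(1))
  have n2: "Linf_norm l {-L..L} (\<lambda>(\<rho>, t). of_real (1 / cosh \<rho>) * partial_t v (\<rho>, t)) \<le> A2 l lam \<phi>0 N * M"
  proof (rule Linf_norm_le[OF _ pos(2)])
    fix r t :: real assume "r \<in> {-L..L}"
    then have "norm (partial_t v (r, t)) / cosh r \<le> A2 l lam \<phi>0 N * M" by (rule le_div[OF b(2) norm_ge_zero])
    then show "norm (case (r, t) of (\<rho>, t) \<Rightarrow> of_real (1 / cosh \<rho>) * partial_t v (\<rho>, t)) \<le> A2 l lam \<phi>0 N * M"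
      by (simp add: norm_divide)
  qed
  have n3: "Linf_norm l {-L..L} (partial_rho v) \<le> A3 l lam \<phi>0 N * M"
  proof (rule Linf_norm_le[OF _ pos(3)])
    fix r t :: real assume "r \<in> {-L..L}"
    then have "norm (cosh r *\<^sub>R partial_rho v (r, t)) / cosh r \<le> A3 l lam \<phi>0 N * M" by (rule le_div[OF b(3) norm_ge_zero])
    then show "norm (partial_rho v (r, t)) \<le> A3 l lam \<phi>0 N * M" by simp
  qed
  have "C1_norm l {-L..L} v \<le> sqrt ((A1 l lam \<phi>0 N * M)\<^sup>2 + (A2 l lam \<phi>0 N * M)\<^sup>2 + (A3 l lam \<phi>0 N * M)\<^sup>2)"
    unfolding C1_norm_def
    by (intro real_sqrt_le_mono add_mono power_mono n1 n2 n3 Linf_norm_nonneg)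
  also have "\<dots> = sqrt (((A1 l lam \<phi>0 N)\<^sup>2 + (A2 l lam \<phi>0 N)\<^sup>2 + (A3 l lam \<phi>0 N)\<^sup>2) * M\<^sup>2)"
    by (simp add: power_mult_distrib algebra_simps)
  also have "\<dots> = beta l lam \<phi>0 N * M" using M0 by (simp add: real_sqrt_mult beta_def)
  finally show ?thesis using n1 unfolding v_def M_def beta_tilde_def by simp
qed

end
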